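(* Let $1<p<\infty$, $-1<\alpha<\infty$, let $K\ge 0$ be an integer, and let $f\in A^p_\alpha$. Suppose that $\|D_\theta^K f\|_{p,\alpha}\le M$. Then for every integer $n\ge1$, $$E_n^{p,\alpha}(f)\le 2^K C_K M n^{-K},$$ where $C_k=\frac4\pi\int_0^\infty|H_k(t)|\,dt$ and $$H_0(t)=\frac{h(t)}{t^2},\qquad H_k(t)=\int_t^\infty H_{k-1}(x)\,dx\ (k\ge1),\qquad h(t)=\frac{\cos(t)-\cos(2t)}{2}.$$
   Context: $\mathbb{D}$ is the open unit disc. For $1<p<\infty$, $\alpha>-1$, the weighted Bergman space $A^p_\alpha$ is the space of analytic functions $f$ in $\mathbb{D}$ with $\|f\|_{p,\alpha}=\left(\int_{\mathbb{D}}|f|^p\,dA_\alpha\right)^{1/p}<\infty$, where $dA_\alpha=(\alpha+1)\pi^{-1}(1-|z|^2)^\alpha\,dA(z)$ and $dA$ is Lebesgue area measure. $D_\theta^K f(re^{i\theta})=\frac{\partial^K}{\partial\theta^K}f(re^{i\theta})$ is the $K$-th derivative in the angular variable. $E_n^{p,\alpha}(f)=\min\{\|f-P\|_{p,\alpha}: P \text{ a polynomial of degree at most } n\}$. *)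

theory Defs
  imports "HOL-Analysis.Analysis" "HOL-Computational_Algebra.Polynomial"
begin

definition disc_measure :: "real \<Rightarrow> complex measure" where
  "disc_measure \<alpha> = density (restrict_space lborel (ball 0 1))
     (\<lambda>z. ennreal ((\<alpha> + 1) / pi * (1 - (cmod z)\<^sup>2) powr \<alpha>))"

text \<open>The norm is extended-real valued, so that \<open>\<parallel>g\<parallel> < \<infinity>\<close> and \<open>\<parallel>g\<parallel> \<le> M\<close> both carry
  the finiteness of the integral. The case distinction is only there because the library
  has no real powers on \<^typ>\<open>ennreal\<close>.\<close>

definition bergman_norm :: "real \<Rightarrow> real \<Rightarrow> (complex \<Rightarrow> complex) \<Rightarrow> ennreal" where
  "bergman_norm p \<alpha> g =
     (let I = (\<integral>\<^sup>+z. ennreal (cmod (g z) powr p) \<partial>disc_measure \<alpha>)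
      in if I = \<infinity> then \<infinity> else ennreal (enn2real I powr (1 / p)))"

definition bergman_space :: "real \<Rightarrow> real \<Rightarrow> (complex \<Rightarrow> complex) set" where
  "bergman_space p \<alpha> = {f. f holomorphic_on ball 0 1 \<and> bergman_norm p \<alpha> f < \<infinity>}"

text \<open>At \<open>z = r e\<^sup>i\<^sup>\<theta>\<close> this is the \<open>K\<close>-th derivative of \<open>\<theta> \<mapsto> f (r e\<^sup>i\<^sup>\<theta>)\<close> with \<open>r\<close> fixed
  (\<open>rcis r \<theta> = r e\<^sup>i\<^sup>\<theta>\<close>). By periodicity the choice of the argument \<^term>\<open>Arg z\<close> is
  immaterial, and at \<open>z = 0\<close> the function differentiated is constant.\<close>

definition angular_deriv :: "nat \<Rightarrow> (complex \<Rightarrow> complex) \<Rightarrow> complex \<Rightarrow> complex" where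
  "angular_deriv K f z =
     ((\<lambda>g \<theta>. vector_derivative g (at \<theta>)) ^^ K) (\<lambda>\<theta>. f (rcis (cmod z) \<theta>)) (Arg z)"

text \<open>\<open>LEAST\<close> on \<^typ>\<open>ennreal\<close> is the minimum of the set, not merely its infimum.\<close>

definition best_approx :: "real \<Rightarrow> real \<Rightarrow> nat \<Rightarrow> (complex \<Rightarrow> complex) \<Rightarrow> ennreal" where
  "best_approx p \<alpha> n f =
     (LEAST e. \<exists>P :: complex poly. degree P \<le> n \<and> e = bergman_norm p \<alpha> (\<lambda>z. f z - poly P z))"

definition h_fun :: "real \<Rightarrow> real" where
  "h_fun t = (cos t - cos (2 * t)) / 2"

text \<open>All these functions are \<open>O(t\<^sup>-\<^sup>2)\<close> at infinity and bounded on \<open>[0, \<infinity>)\<close>, so the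
  integrals below converge absolutely for \<open>t \<ge> 0\<close>.\<close>

primrec H_fun :: "nat \<Rightarrow> real \<Rightarrow> real" where
  "H_fun 0 = (\<lambda>t. h_fun t / t\<^sup>2)"
| "H_fun (Suc k) = (\<lambda>t. LBINT x:{t..}. H_fun k x)"

definition C_const :: "nat \<Rightarrow> real" where
  "C_const k = 4 / pi * (LBINT t:{0..}. \<bar>H_fun k t\<bar>)"

end

theory Submission
  imports Defs "HOL-Probability.Sinc_Integral" "HOL-Complex_Analysis.Great_Picard"
begin

text \<open>Write \<open>a\<^sub>j\<close> for the Taylor coefficients of \<open>f\<close> and \<open>v\<close> for the trapezoidal multiplier that is 1 on
  \<open>[-1, 1]\<close> and 0 outside \<open>[-2, 2]\<close>; its Fourier kernel is \<open>2 H\<^sub>0 / \<pi>\<close>. The polynomial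
  \<open>P = \<Sum> v(2j/n) a\<^sub>j z\<^sup>j\<close> leaves the error \<open>f - P\<close> with multiplier \<open>1 - v\<close>. Integrating
  the kernel by parts \<open>K\<close> times, \<open>(1 - v(x)) / (ix)\<^sup>K\<close> is, up to sign, the transform of
  \<open>2/\<pi>\<close> times the even or odd extension of \<open>H\<^sub>K\<close>, whose \<open>L\<^sup>1\<close> norm is \<open>C\<^sub>K\<close>. Hence
  \<open>f - P\<close> is an superposition of rotations of \<open>D\<^sub>\<theta>\<^sup>K f\<close> against a kernel of total variation at most
  \<open>(2/n)\<^sup>K C\<^sub>K\<close>, and rotations preserve the norm. For \<open>K = 0\<close> take \<open>P = 0\<close> and use
  \<open>C\<^sub>0 \<ge> 1\<close>.\<close>

section \<open>Rotations and best approximation in the Bergman norm\<close>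

text \<open>The recursion for \<open>H_fun\<close> hides the main obstacle. Integrating a bound of
  order 1/t^2 over a tail leaves only 1/t, and one more integration diverges, so absolute values
  alone cannot show that the iterated integrals exist; the oscillation of \<open>h_fun\<close> must
  be kept, and the Laplace form does that. A second obstacle is \<open>LEAST\<close> in
  \<open>best_approx\<close>: it gives an upper bound only if the minimum is attained, so a best
  polynomial has to be produced. The superposition is estimated by Minkowski's integral inequality,
  here obtained from Jensen, Tonelli and rotation invariance. The scale 2/n comes from the support
  of v: since v vanishes from 2 on, sampling it at 2j/n kills every coefficient with j at least n.
  The angular derivative contributes (ij)^K while the kernel divides by (2ij/n)^K, which leaves
  (2/n)^K. The case K = 0 stands apart because 1 - v tends to 1 at infinity and so, by
  Riemann-Lebesgue, is not the transform of an integrable kernel.\<close>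

lemma lborel_translate:
  fixes f :: "'a::euclidean_space \<Rightarrow> ennreal"
  assumes [measurable]: "f \<in> borel_measurable borel"
  shows "(\<integral>\<^sup>+x. f (c + x) \<partial>lborel) = (\<integral>\<^sup>+x. f x \<partial>lborel)"
proof -
  have "(\<integral>\<^sup>+x. f x \<partial>lborel) = (\<integral>\<^sup>+x. f x \<partial>distr lborel borel ((+) c))"
    by (simp add: lborel_distr_plus)
  also have "\<dots> = (\<integral>\<^sup>+x. f (c + x) \<partial>lborel)"
    by (subst nn_integral_distr) auto
  finally show ?thesis ..
qed

text \<open>Uniqueness of translation-invariant measures: integrating
  \<open>1\<^sub>A(cx) 1\<^sub>B(cx - y)\<close> in both orders, with \<open>B\<close> the unit disc, compares the two measures
  on \<open>A\<close>, and the rotation preserves \<open>B\<close>.\<close>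

lemma lborel_distr_mult_unit_complex:
  fixes c :: complex
  assumes c: "cmod c = 1"
  shows "distr lborel borel ((*) c) = lborel"
proof (rule measure_eqI)
  fix A assume "A \<in> sets (distr lborel borel ((*) c))"
  then have A[measurable]: "A \<in> sets borel" by simp
  have [measurable]: "ball (0::complex) 1 \<in> sets borel" by simp
  let ?\<beta> = "emeasure lborel (ball (0::complex) 1)"
  have \<beta>: "?\<beta> \<noteq> 0" "?\<beta> \<noteq> \<infinity>"
    using emeasure_ball[of 1 "0::complex"] unit_ball_vol_pos[of 2]
    by (simp_all del: unit_ball_vol_pos)
  have "emeasure (distr lborel borel ((*) c)) A = (\<integral>\<^sup>+x. indicator A (c * x) \<partial>lborel)"
    by (subst nn_integral_indicator[symmetric], simp, subst nn_integral_distr) auto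
  then have "emeasure (distr lborel borel ((*) c)) A * ?\<beta>
      = (\<integral>\<^sup>+x. indicator A (c * x) * ?\<beta> \<partial>lborel)"
    by (simp add: nn_integral_multc)
  also have "\<dots> = (\<integral>\<^sup>+x. \<integral>\<^sup>+y. indicator A (c * x) * indicator (ball 0 1) (c * x - y) \<partial>lborel \<partial>lborel)"
  proof (rule nn_integral_cong)
    fix x
    have "(\<integral>\<^sup>+y. indicator (ball 0 1) (c * x - y) \<partial>lborel) = (\<integral>\<^sup>+y. indicator (ball (c * x) 1) y \<partial>lborel)"
      by (intro nn_integral_cong) (auto simp: indicator_def dist_norm norm_minus_commute)
    also have "\<dots> = emeasure lborel (ball (c * x) 1)"
      by (simp only: nn_integral_indicator sets_lborel open_ball borel_open)
    also have "\<dots> = ?\<beta>" by (simp add: emeasure_ball)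
    finally have *: "(\<integral>\<^sup>+y. indicator (ball 0 1) (c * x - y) \<partial>lborel) = ?\<beta>" .
    show "indicator A (c * x) * ?\<beta>
       = (\<integral>\<^sup>+y. indicator A (c * x) * indicator (ball 0 1) (c * x - y) \<partial>lborel)"
      unfolding *[symmetric] by (rule nn_integral_cmult[symmetric]) measurable
  qed
  also have "\<dots> = (\<integral>\<^sup>+y. \<integral>\<^sup>+x. indicator A (c * x) * indicator (ball 0 1) (c * x - y) \<partial>lborel \<partial>lborel)"
    by (rule lborel_pair.Fubini') measurable
  also have "\<dots> = (\<integral>\<^sup>+y. \<integral>\<^sup>+x. indicator A (y + c * x) * indicator (ball 0 1) (c * x) \<partial>lborel \<partial>lborel)"
  proof (rule nn_integral_cong)
    fix y
    have cc: "c * (y / c + x) = y + c * x" for x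
      using c by (auto simp: field_simps)
    show "(\<integral>\<^sup>+x. indicator A (c * x) * indicator (ball 0 1) (c * x - y) \<partial>lborel)
        = (\<integral>\<^sup>+x. indicator A (y + c * x) * indicator (ball 0 1) (c * x) \<partial>lborel)"
      by (subst lborel_translate[where c = "y / c", symmetric]) (simp_all add: cc)
  qed
  also have "\<dots> = (\<integral>\<^sup>+x. \<integral>\<^sup>+y. indicator A (y + c * x) * indicator (ball 0 1) (c * x) \<partial>lborel \<partial>lborel)"
    by (rule lborel_pair.Fubini'[symmetric]) measurable
  also have "\<dots> = (\<integral>\<^sup>+x. emeasure lborel A * indicator (ball 0 1) (x::complex) \<partial>lborel)"
  proof (rule nn_integral_cong)
    fix x
    have "(\<integral>\<^sup>+y. indicator A (c * x + y) \<partial>lborel) = emeasure lborel A"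
      by (subst lborel_translate) auto
    then show "(\<integral>\<^sup>+y. indicator A (y + c * x) * indicator (ball 0 1) (c * x) \<partial>lborel)
        = emeasure lborel A * indicator (ball 0 1) x"
      using c by (simp add: nn_integral_multc add.commute indicator_def norm_mult)
  qed
  also have "\<dots> = emeasure lborel A * ?\<beta>"
    by (simp add: nn_integral_cmult)
  finally show "emeasure (distr lborel borel ((*) c)) A = emeasure lborel A"
    using \<beta> by (metis mult_divide_eq_ennreal infinity_ennreal_def)
qed auto

section \<open>Weighted area measure on the disc and its invariance under rotations\<close>

lemma sets_disc_measure: "sets (disc_measure \<alpha>) = sets (restrict_space borel (ball 0 1))"
  by (simp add: disc_measure_def sets_restrict_space)

lemma measurable_disc_measure:
  "f \<in> borel_measurable (disc_measure \<alpha>) \<longleftrightarrow> f \<in> borel_measurable (restrict_space borel (ball 0 1))"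
  by (metis measurable_cong_sets sets_disc_measure)

lemma space_disc_measure [simp]: "space (disc_measure \<alpha>) = ball 0 1"
  by (simp add: disc_measure_def space_restrict_space)

lemma continuous_imp_measurable_disc:
  "continuous_on (ball 0 1) f \<Longrightarrow> f \<in> borel_measurable (disc_measure \<alpha>)"
  unfolding measurable_disc_measure by (rule borel_measurable_continuous_on_restrict)

lemma nn_integral_disc_measure:
  assumes "\<phi> \<in> borel_measurable (disc_measure \<alpha>)"
  shows "(\<integral>\<^sup>+z. \<phi> z \<partial>disc_measure \<alpha>)
    = (\<integral>\<^sup>+z. ennreal ((\<alpha> + 1) / pi * (1 - (cmod z)\<^sup>2) powr \<alpha>) * \<phi> z * indicator (ball 0 1) z \<partial>lborel)"
proof -
  have "\<phi> \<in> borel_measurable (restrict_space lborel (ball 0 1))"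
    using assms unfolding measurable_disc_measure
    by (simp add: sets_restrict_space cong: measurable_cong_sets)
  then show ?thesis
    unfolding disc_measure_def
    by (subst nn_integral_density)
       (auto intro!: measurable_restrict_space1 simp: nn_integral_restrict_space)
qed

text \<open>Makes Tonelli available on the product of the disc and the line. A density over a
  sigma-finite measure stays sigma-finite when it is finite almost everywhere, and this one is
  real-valued.\<close>

lemma sigma_finite_disc_measure: "sigma_finite_measure (disc_measure \<alpha>)"
proof -
  interpret R: sigma_finite_measure "restrict_space lborel (ball (0::complex) 1)"
    by (rule sigma_finite_measure_restrict_space) (auto intro: lborel.sigma_finite_measure_axioms)
  show ?thesis
    unfolding disc_measure_def
    by (subst R.sigma_finite_iff_density_finite) (auto intro!: measurable_restrict_space1)
qed

text \<open>The weight depends on the modulus alone, so only Lebesgue measure has to be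
  invariant.\<close>

lemma nn_integral_disc_rotate:
  assumes \<phi>: "\<phi> \<in> borel_measurable (disc_measure \<alpha>)" and c: "cmod c = 1"
  shows "(\<integral>\<^sup>+z. \<phi> (z * c) \<partial>disc_measure \<alpha>) = (\<integral>\<^sup>+z. \<phi> z \<partial>disc_measure \<alpha>)"
proof -
  let ?w = "\<lambda>z. ennreal ((\<alpha> + 1) / pi * (1 - (cmod z)\<^sup>2) powr \<alpha>)"
  \<comment> \<open>Extension by zero: the change of variables takes place in the whole plane, while
    \<open>\<phi>\<close> is known to be measurable only on the disc.\<close>
  have \<phi>'[measurable]: "(\<lambda>z. \<phi> z * indicator (ball 0 1) z) \<in> borel_measurable borel"
    using \<phi> unfolding measurable_disc_measure
    by (subst (asm) borel_measurable_restrict_space_iff_ennreal) (auto simp: mult.commute)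
  have "(\<lambda>z. z * c) \<in> measurable (restrict_space borel (ball 0 1)) (restrict_space borel (ball 0 1))"
    using c by (intro measurable_restrict_space3) (auto simp: norm_mult)
  then have \<phi>c: "(\<lambda>z. \<phi> (z * c)) \<in> borel_measurable (disc_measure \<alpha>)"
    using \<phi> unfolding measurable_disc_measure by (rule measurable_compose)
  have "(\<integral>\<^sup>+z. \<phi> z \<partial>disc_measure \<alpha>) = (\<integral>\<^sup>+z. ?w z * (\<phi> z * indicator (ball 0 1) z) \<partial>lborel)"
    by (simp add: nn_integral_disc_measure[OF \<phi>] mult_ac)
  also have "\<dots> = (\<integral>\<^sup>+z. ?w z * (\<phi> z * indicator (ball 0 1) z) \<partial>distr lborel borel ((*) c))"
    using c by (simp add: lborel_distr_mult_unit_complex)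
  also have "\<dots> = (\<integral>\<^sup>+z. ?w (c * z) * (\<phi> (c * z) * indicator (ball 0 1) (c * z)) \<partial>lborel)"
    by (subst nn_integral_distr) auto
  also have "\<dots> = (\<integral>\<^sup>+z. ?w z * \<phi> (z * c) * indicator (ball 0 1) z \<partial>lborel)"
    using c by (intro nn_integral_cong) (auto simp: norm_mult indicator_def mult_ac)
  also have "\<dots> = (\<integral>\<^sup>+z. \<phi> (z * c) \<partial>disc_measure \<alpha>)"
    by (simp add: nn_integral_disc_measure[OF \<phi>c])
  finally show ?thesis ..
qed

section \<open>Jensen's inequality and averages of rotations\<close>

text \<open>Convexity of the power function, taken from Young's inequality with exponents p and
  p/(p-1) for y and a^(p-1). This covers a = 0 and y = 0 without differentiating there.\<close>

lemma powr_above_tangent: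
  fixes p a y :: real
  assumes "1 < p" "0 \<le> a" "0 \<le> y"
  shows "a powr p + p * a powr (p - 1) * (y - a) \<le> y powr p"
proof -
  have "y * a powr (p - 1) \<le> y powr p / p + (a powr (p - 1)) powr (p / (p - 1)) / (p / (p - 1))"
    using assms by (intro Youngs_inequality) (auto simp: field_simps)
  also have "(a powr (p - 1)) powr (p / (p - 1)) = a powr p"
    using assms by (simp add: powr_powr)
  finally have "p * (y * a powr (p - 1)) \<le> p * (y powr p / p + a powr p / (p / (p - 1)))"
    using assms by (intro mult_left_mono) auto
  also have "\<dots> = y powr p + (p - 1) * a powr p"
    using assms by (simp add: field_simps)
  also have "a powr p = a powr (p - 1) * a"
    using assms by (cases "a = 0") (auto simp: powr_diff)
  finally show ?thesis
    using \<open>a powr p = a powr (p - 1) * a\<close> by (simp add: algebra_simps)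
qed

text \<open>The tangent is taken at the \<open>w\<close>-mean of \<open>G\<close>, where the linear
  term integrates to zero. The power of the total mass appears because \<open>w\<close> is not
  normalised.\<close>

lemma jensen_powr_weighted:
  fixes w G :: "'a \<Rightarrow> real"
  assumes p: "1 < p"
    and w: "integrable M w" "\<And>x. 0 \<le> w x" and G0: "\<And>x. 0 \<le> G x"
    and wG: "integrable M (\<lambda>x. w x * G x)" and wGp: "integrable M (\<lambda>x. w x * G x powr p)"
  shows "(\<integral>x. w x * G x \<partial>M) powr p \<le> (\<integral>x. w x \<partial>M) powr (p - 1) * (\<integral>x. w x * G x powr p \<partial>M)"
proof (cases "(\<integral>x. w x \<partial>M) = 0")
  case True
  then have "AE x in M. w x = 0"
    using w by (subst (asm) integral_nonneg_eq_0_iff_AE) auto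
  then have "(\<integral>x. w x * G x \<partial>M) = 0"
    by (intro integral_eq_zero_AE) auto
  then show ?thesis using True by simp
next
  case False
  define B where "B = (\<integral>x. w x \<partial>M)"
  define a where "a = (\<integral>x. w x * G x \<partial>M) / B"
  have B: "B > 0"
    using False w(2) Bochner_Integration.integral_nonneg[of M w] by (simp add: B_def less_le)
  have a: "a \<ge> 0" using B w(2) G0 by (simp add: a_def)
  have "B * a powr p = (\<integral>x. a powr p * w x + p * a powr (p - 1) * (w x * G x - a * w x) \<partial>M)"
    using w wG B by (simp add: B_def[symmetric] a_def)
  also have "\<dots> \<le> (\<integral>x. w x * G x powr p \<partial>M)"
  proof (rule integral_mono)
    fix x
    have "w x * (a powr p + p * a powr (p - 1) * (G x - a)) \<le> w x * G x powr p"
      using powr_above_tangent[OF p a G0] w(2) by (intro mult_left_mono)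
    then show "a powr p * w x + p * a powr (p - 1) * (w x * G x - a * w x) \<le> w x * G x powr p"
      by (simp add: algebra_simps)
  qed (use w wG wGp in auto)
  finally have "B powr (p - 1) * (B * a powr p) \<le> B powr (p - 1) * (\<integral>x. w x * G x powr p \<partial>M)"
    by (intro mult_left_mono) auto
  moreover have "(\<integral>x. w x * G x \<partial>M) powr p = B powr (p - 1) * (B * a powr p)"
  proof -
    have "(\<integral>x. w x * G x \<partial>M) = B * a" using B by (simp add: a_def)
    then show ?thesis using B a by (simp add: powr_mult powr_diff)
  qed
  ultimately show ?thesis by (simp add: B_def)
qed

lemma continuous_on_circle:
  assumes g: "continuous_on (ball 0 1) g" and z: "z \<in> ball 0 1"
  shows "continuous_on UNIV (\<lambda>t. g (z * cis (c * t)))"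
  by (rule continuous_on_compose2[OF g]) (use z in \<open>auto intro!: continuous_intros simp: norm_mult\<close>)

text \<open>A continuous function on the open disc may be unbounded, but the orbit of one point
  under rotations lies on a compact circle. This makes the averages over rotations converge at each
  z.\<close>

lemma bounded_on_circle:
  fixes g :: "complex \<Rightarrow> complex"
  assumes g: "continuous_on (ball 0 1) g" and z: "z \<in> ball 0 1"
  obtains B where "\<And>t::real. cmod (g (z * cis (c * t))) \<le> B"
proof -
  have "bounded (g ` sphere 0 (cmod z))"
    using z by (intro compact_imp_bounded compact_continuous_image continuous_on_subset[OF g]) auto
  then obtain B where B: "\<And>w. cmod w = cmod z \<Longrightarrow> cmod (g w) \<le> B"
    unfolding bounded_iff by (metis dist_0_norm imageI mem_sphere)
  show thesis
    by (rule that[of B]) (auto intro!: B simp: norm_mult)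
qed

text \<open>Minkowski's integral inequality for a rotation-invariant norm: Jensen with weight |L| at
  each z, then Tonelli. The inner integral over the disc no longer depends on the angle, and the
  masses B^(p-1) and B multiply to B^p.\<close>

lemma nn_integral_powr_convolution_le:
  fixes L :: "real \<Rightarrow> real" and g :: "complex \<Rightarrow> complex"
  assumes p: "1 < p" and L: "integrable lborel L" and g: "continuous_on (ball 0 1) g"
  shows "(\<integral>\<^sup>+z. ennreal (cmod (\<integral>t. L t *\<^sub>R g (z * cis (c * t)) \<partial>lborel) powr p) \<partial>disc_measure \<alpha>)
    \<le> ennreal ((\<integral>t. \<bar>L t\<bar> \<partial>lborel) powr p) * (\<integral>\<^sup>+z. ennreal (cmod (g z) powr p) \<partial>disc_measure \<alpha>)"
proof -
  define B where "B = (\<integral>t. \<bar>L t\<bar> \<partial>lborel)"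
  have B: "B \<ge> 0" by (simp add: B_def)
  have Lm[measurable]: "L \<in> borel_measurable borel" using L by auto
  let ?G = "\<lambda>z t. cmod (g (z * cis (c * t)))"
  have gG[measurable]: "(\<lambda>t. g (z * cis (c * t))) \<in> borel_measurable borel" if "z \<in> ball 0 1" for z
    using continuous_on_circle[OF g that] by (rule borel_measurable_continuous_onI)
  have pointwise: "ennreal (cmod (\<integral>t. L t *\<^sub>R g (z * cis (c * t)) \<partial>lborel) powr p)
      \<le> (\<integral>\<^sup>+t. ennreal (B powr (p - 1)) * (ennreal \<bar>L t\<bar> * ennreal (?G z t powr p)) \<partial>lborel)"
    if z: "z \<in> ball 0 1" for z
  proof -
    note [measurable] = gG[OF z]
    obtain b where b: "\<And>t. ?G z t \<le> b" using bounded_on_circle[OF g z] by metis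
    have b': "?G z t powr p \<le> b powr p" for t using b p by (intro powr_mono2) auto
    have iG: "integrable lborel (\<lambda>t. \<bar>L t\<bar> * ?G z t)"
    proof (rule Bochner_Integration.integrable_bound[where f = "\<lambda>t. b * L t"])
      show "AE t in lborel. norm (\<bar>L t\<bar> * ?G z t) \<le> norm (b * L t)"
      proof (rule AE_I2)
        fix t show "norm (\<bar>L t\<bar> * ?G z t) \<le> norm (b * L t)"
          using mult_left_mono[OF b[of t], of "\<bar>L t\<bar>"] order_trans[OF norm_ge_zero b[of t]]
          by (simp add: abs_mult mult.commute)
      qed
    qed (use L in auto)
    have iGp: "integrable lborel (\<lambda>t. \<bar>L t\<bar> * ?G z t powr p)"
    proof (rule Bochner_Integration.integrable_bound[where f = "\<lambda>t. b powr p * L t"])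
      show "AE t in lborel. norm (\<bar>L t\<bar> * ?G z t powr p) \<le> norm (b powr p * L t)"
      proof (rule AE_I2)
        fix t show "norm (\<bar>L t\<bar> * ?G z t powr p) \<le> norm (b powr p * L t)"
          using mult_left_mono[OF b'[of t], of "\<bar>L t\<bar>"]
          by (simp add: abs_mult mult.commute)
      qed
    qed (use L in auto)
    have "cmod (\<integral>t. L t *\<^sub>R g (z * cis (c * t)) \<partial>lborel) \<le> (\<integral>t. norm (L t *\<^sub>R g (z * cis (c * t))) \<partial>lborel)"
      by (rule integral_norm_bound)
    then have "cmod (\<integral>t. L t *\<^sub>R g (z * cis (c * t)) \<partial>lborel) powr p \<le> (\<integral>t. \<bar>L t\<bar> * ?G z t \<partial>lborel) powr p"
      using p by (intro powr_mono2) auto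
    also have "\<dots> \<le> B powr (p - 1) * (\<integral>t. \<bar>L t\<bar> * ?G z t powr p \<partial>lborel)"
      unfolding B_def using p L iG iGp by (intro jensen_powr_weighted) auto
    finally have "ennreal (cmod (\<integral>t. L t *\<^sub>R g (z * cis (c * t)) \<partial>lborel) powr p)
        \<le> ennreal (B powr (p - 1) * (\<integral>t. \<bar>L t\<bar> * ?G z t powr p \<partial>lborel))"
      by (rule ennreal_leI)
    also have "\<dots> = ennreal (B powr (p - 1)) * (\<integral>\<^sup>+t. ennreal (\<bar>L t\<bar> * ?G z t powr p) \<partial>lborel)"
      using iGp by (subst nn_integral_eq_integral) (auto simp: ennreal_mult')
    also have "\<dots> = (\<integral>\<^sup>+t. ennreal (B powr (p - 1)) * (ennreal \<bar>L t\<bar> * ennreal (?G z t powr p)) \<partial>lborel)"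
      by (subst nn_integral_cmult[symmetric]) (auto simp: ennreal_mult')
    finally show ?thesis .
  qed
  have gm: "(\<lambda>z. ennreal (cmod (g z) powr p)) \<in> borel_measurable (disc_measure \<alpha>)"
    using continuous_imp_measurable_disc[OF g] by measurable
  interpret D: sigma_finite_measure "disc_measure \<alpha>"
    by (rule sigma_finite_disc_measure)
  interpret P: pair_sigma_finite "disc_measure \<alpha>" lborel ..
  \<comment> \<open>Joint measurability goes through the restricted sigma-algebra of the disc, since
    nothing is known about \<open>g\<close> outside it; rotations map the disc into itself.\<close>
  have pm: "(\<lambda>(z, t). ennreal (?G z t powr p)) \<in> borel_measurable (disc_measure \<alpha> \<Otimes>\<^sub>M lborel)"
  proof -
    have "(\<lambda>(z, t). z * cis (c * t)) \<in> measurable (restrict_space borel (ball 0 1) \<Otimes>\<^sub>M borel) (restrict_space borel (ball 0 1))"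
    proof (rule measurable_restrict_space2)
      have "(\<lambda>x. fst x) \<in> measurable (restrict_space borel (ball 0 1) \<Otimes>\<^sub>M borel) (borel :: complex measure)"
        by (rule measurable_compose[OF measurable_fst]) (simp add: measurable_restrict_space1)
      moreover have "(\<lambda>t. cis (c * t)) \<in> borel_measurable borel"
        by (intro borel_measurable_continuous_onI continuous_intros)
      then have "(\<lambda>x. cis (c * snd x)) \<in> borel_measurable (restrict_space borel (ball (0::complex) 1) \<Otimes>\<^sub>M borel)"
        by (rule measurable_compose[OF measurable_snd])
      ultimately show "(\<lambda>(z, t). z * cis (c * t)) \<in> borel_measurable (restrict_space borel (ball 0 1) \<Otimes>\<^sub>M borel)"
        unfolding case_prod_beta' by (rule borel_measurable_times)
    qed (auto simp: space_pair_measure space_restrict_space norm_mult)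
    then have "(\<lambda>x. ennreal (cmod (g ((\<lambda>(z, t). z * cis (c * t)) x)) powr p)) \<in> borel_measurable (restrict_space borel (ball 0 1) \<Otimes>\<^sub>M borel)"
      using gm unfolding measurable_disc_measure by (rule measurable_compose)
    also have "(restrict_space borel (ball 0 1) \<Otimes>\<^sub>M borel \<rightarrow>\<^sub>M borel) = (disc_measure \<alpha> \<Otimes>\<^sub>M lborel \<rightarrow>\<^sub>M (borel::ennreal measure))"
      by (intro measurable_cong_sets sets_pair_measure_cong) (auto simp: sets_disc_measure)
    finally show ?thesis by (simp add: case_prod_beta')
  qed
  have "(\<integral>\<^sup>+z. ennreal (cmod (\<integral>t. L t *\<^sub>R g (z * cis (c * t)) \<partial>lborel) powr p) \<partial>disc_measure \<alpha>)
     \<le> (\<integral>\<^sup>+z. \<integral>\<^sup>+t. ennreal (B powr (p - 1)) * (ennreal \<bar>L t\<bar> * ennreal (?G z t powr p)) \<partial>lborel \<partial>disc_measure \<alpha>)"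
    by (intro nn_integral_mono pointwise) auto
  also have "\<dots> = (\<integral>\<^sup>+t. \<integral>\<^sup>+z. ennreal (B powr (p - 1)) * (ennreal \<bar>L t\<bar> * ennreal (?G z t powr p)) \<partial>disc_measure \<alpha> \<partial>lborel)"
    using pm by (intro P.Fubini'[symmetric]) (simp add: case_prod_beta')
  also have "\<dots> = (\<integral>\<^sup>+t. ennreal (B powr (p - 1)) * (ennreal \<bar>L t\<bar> * (\<integral>\<^sup>+z. ennreal (cmod (g z) powr p) \<partial>disc_measure \<alpha>)) \<partial>lborel)"
  proof (rule nn_integral_cong)
    fix t :: real
    have rot: "(\<lambda>z. ennreal (?G z t powr p)) \<in> borel_measurable (disc_measure \<alpha>)"
      using measurable_Pair1[OF pm, of t] by (simp only: prod.case space_lborel space_borel UNIV_I simp_thms)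
    show "(\<integral>\<^sup>+z. ennreal (B powr (p - 1)) * (ennreal \<bar>L t\<bar> * ennreal (?G z t powr p)) \<partial>disc_measure \<alpha>)
       = ennreal (B powr (p - 1)) * (ennreal \<bar>L t\<bar> * (\<integral>\<^sup>+z. ennreal (cmod (g z) powr p) \<partial>disc_measure \<alpha>))"
      using rot nn_integral_disc_rotate[OF gm, of "cis (c * t)"]
      by (simp add: nn_integral_cmult)
  qed
  also have "\<dots> = ennreal (B powr (p - 1)) * ((\<integral>\<^sup>+t. ennreal \<bar>L t\<bar> \<partial>lborel) * (\<integral>\<^sup>+z. ennreal (cmod (g z) powr p) \<partial>disc_measure \<alpha>))"
    by (simp add: nn_integral_cmult nn_integral_multc)
  also have "(\<integral>\<^sup>+t. ennreal \<bar>L t\<bar> \<partial>lborel) = ennreal B"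
    unfolding B_def using L by (intro nn_integral_eq_integral) auto
  also have "ennreal (B powr (p - 1)) * (ennreal B * (\<integral>\<^sup>+z. ennreal (cmod (g z) powr p) \<partial>disc_measure \<alpha>))
      = ennreal (B powr p) * (\<integral>\<^sup>+z. ennreal (cmod (g z) powr p) \<partial>disc_measure \<alpha>)"
    using B by (cases "B = 0") (auto simp: mult.assoc[symmetric] ennreal_mult'[symmetric] powr_diff)
  finally show ?thesis by (simp add: B_def)
qed

lemma bergman_norm_mono_integral:
  assumes "1 < p" "(\<integral>\<^sup>+z. ennreal (cmod (f z) powr p) \<partial>disc_measure \<alpha>)
    \<le> (\<integral>\<^sup>+z. ennreal (cmod (g z) powr p) \<partial>disc_measure \<alpha>)"
  shows "bergman_norm p \<alpha> f \<le> bergman_norm p \<alpha> g"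
  using assms by (auto simp: bergman_norm_def Let_def top_unique less_top
      intro!: ennreal_leI powr_mono2 enn2real_mono)

text \<open>Replaces the root, which is defined by cases, with p-th powers, where integral
  inequalities apply. An infinite integral makes both sides false.\<close>

lemma bergman_norm_le_iff:
  assumes p: "1 < p" and "0 \<le> M"
  shows "bergman_norm p \<alpha> f \<le> ennreal M
    \<longleftrightarrow> (\<integral>\<^sup>+z. ennreal (cmod (f z) powr p) \<partial>disc_measure \<alpha>) \<le> ennreal (M powr p)"
proof -
  define I where "I = (\<integral>\<^sup>+z. ennreal (cmod (f z) powr p) \<partial>disc_measure \<alpha>)"
  show ?thesis
  proof (cases I)
    case (real r)
    have "r powr (1 / p) \<le> M \<longleftrightarrow> r \<le> M powr p"
      using p \<open>0 \<le> M\<close> real powr_mono2[of p "r powr (1 / p)" M] powr_mono2[of "1 / p" r "M powr p"]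
      by (auto simp: powr_powr)
    then show ?thesis
      using real \<open>0 \<le> M\<close> by (simp add: bergman_norm_def I_def[symmetric])
  next
    case top
    then show ?thesis by (simp add: bergman_norm_def I_def[symmetric] top_unique)
  qed
qed

lemma bergman_norm_convolution_le:
  fixes L :: "real \<Rightarrow> real" and g :: "complex \<Rightarrow> complex"
  assumes p: "1 < p" and M: "0 \<le> M" and L: "integrable lborel L" and g: "continuous_on (ball 0 1) g"
    and gM: "bergman_norm p \<alpha> g \<le> ennreal M"
  shows "bergman_norm p \<alpha> (\<lambda>z. \<integral>t. L t *\<^sub>R g (z * cis (c * t)) \<partial>lborel)
    \<le> ennreal ((\<integral>t. \<bar>L t\<bar> \<partial>lborel) * M)"
proof -
  have "(\<integral>\<^sup>+z. ennreal (cmod (\<integral>t. L t *\<^sub>R g (z * cis (c * t)) \<partial>lborel) powr p) \<partial>disc_measure \<alpha>)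
    \<le> ennreal ((\<integral>t. \<bar>L t\<bar> \<partial>lborel) powr p) * (\<integral>\<^sup>+z. ennreal (cmod (g z) powr p) \<partial>disc_measure \<alpha>)"
    by (rule nn_integral_powr_convolution_le[OF p L g])
  also have "\<dots> \<le> ennreal ((\<integral>t. \<bar>L t\<bar> \<partial>lborel) powr p) * ennreal (M powr p)"
    using gM by (intro mult_left_mono) (simp_all add: bergman_norm_le_iff[OF p M])
  also have "\<dots> = ennreal (((\<integral>t. \<bar>L t\<bar> \<partial>lborel) * M) powr p)"
    using M by (simp add: ennreal_mult'[symmetric] powr_mult)
  finally show ?thesis
    using p M by (subst bergman_norm_le_iff) auto
qed

section \<open>Existence of a best approximating polynomial\<close>

text \<open>Definiteness of the norm on polynomials: the weight is positive throughout the disc and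
  a nonzero polynomial has finitely many roots, so a zero integral would make the disc a null
  set.\<close>

lemma nn_integral_disc_measure_eq_0_poly:
  fixes Q :: "complex poly"
  assumes \<alpha>: "-1 < \<alpha>" and "(\<integral>\<^sup>+z. ennreal (cmod (poly Q z) powr p) \<partial>disc_measure \<alpha>) = 0"
  shows "Q = 0"
proof (rule ccontr)
  assume "Q \<noteq> 0"
  have "(\<lambda>z. ennreal (cmod (poly Q z) powr p)) \<in> borel_measurable (disc_measure \<alpha>)"
    by (intro measurable_compose[OF continuous_imp_measurable_disc[of "poly Q"]])
       (auto intro!: continuous_intros)
  with assms(2) have int0: "(\<integral>\<^sup>+z. ennreal ((\<alpha> + 1) / pi * (1 - (cmod z)\<^sup>2) powr \<alpha>)
      * ennreal (cmod (poly Q z) powr p) * indicator (ball 0 1) z \<partial>lborel) = 0"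
    by (simp only: nn_integral_disc_measure)
  have [measurable]: "ball (0::complex) 1 \<in> sets borel" by simp
  have [measurable]: "poly Q \<in> borel_measurable borel"
    by (intro borel_measurable_continuous_onI continuous_intros)
  have "(\<lambda>z. ennreal ((\<alpha> + 1) / pi * (1 - (cmod z)\<^sup>2) powr \<alpha>)
      * ennreal (cmod (poly Q z) powr p) * indicator (ball 0 1) z) \<in> borel_measurable lborel"
    by measurable
  then have "AE z in lborel. ennreal ((\<alpha> + 1) / pi * (1 - (cmod z)\<^sup>2) powr \<alpha>)
      * ennreal (cmod (poly Q z) powr p) * indicator (ball 0 1) z = 0"
    using int0 by (rule iffD1[OF nn_integral_0_iff_AE])
  moreover have "AE z in lborel. z \<notin> {z. poly Q z = 0}"
    by (intro AE_not_in countable_imp_null_set_lborel countable_finite poly_roots_finite \<open>Q \<noteq> 0\<close>)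
  ultimately have "AE z in lborel. z \<notin> ball (0::complex) 1"
  proof eventually_elim
    case (elim z)
    show ?case
    proof
      assume z: "z \<in> ball 0 1"
      then have "(cmod z)\<^sup>2 < 1\<^sup>2" by (intro power_strict_mono) auto
      then have "0 < (1 - (cmod z)\<^sup>2) powr \<alpha>" by simp
      then have "0 < (\<alpha> + 1) / pi * (1 - (cmod z)\<^sup>2) powr \<alpha>" using \<alpha> by simp
      then show False using elim z by (auto simp: ennreal_eq_0_iff not_le[symmetric])
    qed
  qed
  then have "emeasure lborel (ball (0::complex) 1) = 0"
    by (subst (asm) AE_iff_measurable[OF _ refl]) (auto simp: ball_def)
  then show False
    using emeasure_ball[of 1 "0::complex"] unit_ball_vol_pos[of 2] by (simp del: unit_ball_vol_pos)
qed

text \<open>Coefficient vectors of a minimising sequence stay bounded: otherwise, after normalising, Fatou's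
  lemma would produce a nonzero polynomial of norm zero.\<close>

lemma best_poly_exists:
  assumes p: "1 < p" and \<alpha>: "-1 < \<alpha>" and f: "f \<in> borel_measurable (disc_measure \<alpha>)"
    and fin: "(\<integral>\<^sup>+z. ennreal (cmod (f z) powr p) \<partial>disc_measure \<alpha>) < \<infinity>"
  defines "I \<equiv> \<lambda>P. \<integral>\<^sup>+z. ennreal (cmod (f z - poly P z) powr p) \<partial>disc_measure \<alpha>"
  shows "\<exists>P. degree P \<le> n \<and> (\<forall>Q. degree Q \<le> n \<longrightarrow> I P \<le> I Q)"
proof -
  define \<iota> where "\<iota> = (INF P\<in>{P. degree P \<le> n}. I P)"
  have \<iota>_le: "\<iota> \<le> I P" if "degree P \<le> n" for P
    unfolding \<iota>_def using that by (auto intro: INF_lower)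
  have \<iota>_fin: "\<iota> < \<infinity>"
    using \<iota>_le[of 0] fin by (simp add: I_def le_less_trans)
  have "\<exists>P. degree P \<le> n \<and> I P \<le> \<iota> + ennreal (1 / real (Suc k))" for k
  proof -
    have "\<iota> < \<iota> + ennreal (1 / real (Suc k))"
      using \<iota>_fin by (cases \<iota>) (auto simp flip: ennreal_plus intro!: ennreal_lessI add_nonneg_pos)
    then have "\<exists>P\<in>{P. degree P \<le> n}. I P < \<iota> + ennreal (1 / real (Suc k))"
      by (simp only: INF_less_iff[symmetric] \<iota>_def[symmetric])
    then show ?thesis by (auto intro: less_imp_le)
  qed
  then obtain P where P: "\<And>k. degree (P k) \<le> n" "\<And>k. I (P k) \<le> \<iota> + ennreal (1 / real (Suc k))"
    by metis
  define B where "B = enn2real \<iota> + 1"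
  have IB: "I (P k) \<le> ennreal B" for k
  proof -
    have "\<iota> + ennreal (1 / real (Suc k)) \<le> \<iota> + ennreal 1"
      by (intro add_left_mono ennreal_leI) auto
    also have "\<dots> = ennreal B"
      using \<iota>_fin by (cases \<iota>) (auto simp: B_def ennreal_plus)
    finally show ?thesis using P(2)[of k] by (rule order_trans[rotated])
  qed
  \<comment> \<open>The summand 1 keeps \<open>c k\<close> away from zero, so division is safe even
    for the zero polynomial, and 1/\<open>c k\<close> stays between 0 and 1.\<close>
  define c where "c k = 1 + (\<Sum>j\<le>n. cmod (coeff (P k) j))" for k
  have c1: "1 \<le> c k" for k by (simp add: c_def sum_nonneg)
  have cj: "cmod (coeff (P k) j) \<le> c k" if "j \<le> n" for k j
    using that member_le_sum[of j "{..n}" "\<lambda>j. cmod (coeff (P k) j)"] by (simp add: c_def)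
  have poly_sum: "poly (P k) z = (\<Sum>j\<le>n. coeff (P k) j * z ^ j)" for k z
  proof -
    have "(\<Sum>j\<le>n. coeff (P k) j * z ^ j) = (\<Sum>j\<le>degree (P k). coeff (P k) j * z ^ j)"
      using P(1)[of k] by (intro sum.mono_neutral_right) (auto simp: coeff_eq_0)
    then show ?thesis by (simp add: poly_altdef)
  qed
  have mf: "(\<lambda>z. cmod (u * f z - poly Q z) powr p) \<in> borel_measurable (disc_measure \<alpha>)" for u Q
    using f continuous_imp_measurable_disc[of "poly Q" \<alpha>] by (simp add: continuous_on_poly)

  \<comment> \<open>Index \<open>Suc n\<close> stores the scale 1/\<open>c k\<close> beside the
    normalised coefficients, so that a single subsequence makes all of them converge.\<close>
  define F :: "nat \<Rightarrow> nat \<Rightarrow> complex"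
    where "F k j = (if j = Suc n then of_real (1 / c k) else coeff (P k) j / c k)" for k j
  have F1: "norm (F k j) \<le> 1" if "j \<in> {..Suc n}" for k j
    using that c1[of k] cj[of j k] by (auto simp: F_def norm_divide le_Suc_eq)
  have "countable {..Suc n}" by simp
  then obtain \<sigma> :: "nat \<Rightarrow> nat" where \<sigma>: "strict_mono \<sigma>"
    and lim: "\<And>j. j \<in> {..Suc n} \<Longrightarrow> \<exists>l. (\<lambda>k. F (\<sigma> k) j) \<longlonglongrightarrow> l"
    by (rule function_convergent_subsequence[of "{..Suc n}" F 1]) (auto intro: F1)
  obtain u where u: "(\<lambda>k. of_real (1 / c (\<sigma> k)) :: complex) \<longlonglongrightarrow> u"
    using lim[of "Suc n"] by (auto simp: F_def)
  have "\<exists>a. \<forall>j\<le>n. (\<lambda>k. coeff (P (\<sigma> k)) j / c (\<sigma> k)) \<longlonglongrightarrow> a j"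
  proof -
    have "\<forall>j. \<exists>l. j \<le> n \<longrightarrow> (\<lambda>k. coeff (P (\<sigma> k)) j / c (\<sigma> k)) \<longlonglongrightarrow> l"
    proof
      fix j
      show "\<exists>l. j \<le> n \<longrightarrow> (\<lambda>k. coeff (P (\<sigma> k)) j / c (\<sigma> k)) \<longlonglongrightarrow> l"
        using lim[of j] by (cases "j \<le> n") (auto simp: F_def)
    qed
    then show ?thesis by metis
  qed
  then obtain a where a: "\<And>j. j \<le> n \<Longrightarrow> (\<lambda>k. coeff (P (\<sigma> k)) j / c (\<sigma> k)) \<longlonglongrightarrow> a j" by blast
  define Q where "Q = (\<Sum>j\<le>n. monom (a j) j)"
  have degQ: "degree Q \<le> n"
    unfolding Q_def by (intro degree_sum_le) (auto intro: order_trans[OF degree_monom_le])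
  have polyQ: "poly Q z = (\<Sum>j\<le>n. a j * z ^ j)" for z
    by (simp add: Q_def poly_sum poly_monom Polynomial.poly_sum)
  have coeffQ: "coeff Q j = a j" if "j \<le> n" for j
    using that by (simp add: Q_def coeff_sum sum.delta)
  \<comment> \<open>Used twice: for the normalised sequence, where the factor \<open>v k\<close>
    tends to \<open>u\<close>, and with factor 1 for the original one.\<close>
  have fatou: "(\<integral>\<^sup>+z. ennreal (cmod (w z) powr p) \<partial>disc_measure \<alpha>)
      \<le> liminf (\<lambda>k. \<integral>\<^sup>+z. ennreal (cmod (v k * f z - poly (R k) z) powr p) \<partial>disc_measure \<alpha>)"
    if w: "\<And>z. (\<lambda>k. v k * f z - poly (R k) z) \<longlonglongrightarrow> w z" for v R w
  proof -
    have "(\<integral>\<^sup>+z. ennreal (cmod (w z) powr p) \<partial>disc_measure \<alpha>)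
      = (\<integral>\<^sup>+z. liminf (\<lambda>k. ennreal (cmod (v k * f z - poly (R k) z) powr p)) \<partial>disc_measure \<alpha>)"
      using p by (intro nn_integral_cong lim_imp_Liminf[symmetric] tendsto_ennrealI tendsto_powr'
          tendsto_norm w tendsto_const) auto
    also have "\<dots> \<le> liminf (\<lambda>k. \<integral>\<^sup>+z. ennreal (cmod (v k * f z - poly (R k) z) powr p) \<partial>disc_measure \<alpha>)"
      by (intro nn_integral_liminf measurable_compose[OF mf measurable_ennreal])
    finally show ?thesis .
  qed
  have scaled: "(\<integral>\<^sup>+z. ennreal (cmod (of_real (1 / c (\<sigma> k)) * f z - poly (smult (1 / c (\<sigma> k)) (P (\<sigma> k))) z) powr p) \<partial>disc_measure \<alpha>)
       = ennreal ((1 / c (\<sigma> k)) powr p) * I (P (\<sigma> k))" for k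
  proof -
    have "cmod (of_real (1 / c (\<sigma> k)) * f z - poly (smult (1 / c (\<sigma> k)) (P (\<sigma> k))) z) powr p
       = (1 / c (\<sigma> k)) powr p * cmod (f z - poly (P (\<sigma> k)) z) powr p" for z
    proof -
      have "of_real (1 / c (\<sigma> k)) * f z - poly (smult (1 / c (\<sigma> k)) (P (\<sigma> k))) z = of_real (1 / c (\<sigma> k)) * (f z - poly (P (\<sigma> k)) z)"
        by (simp add: diff_divide_distrib)
      then show ?thesis
        using c1[of "\<sigma> k"] by (simp only: norm_mult norm_of_real) (simp add: powr_mult powr_divide)
    qed
    then show ?thesis
      using measurable_compose[OF mf[of 1 "P (\<sigma> k)"] measurable_ennreal] unfolding I_def
      by (simp add: ennreal_mult' nn_integral_cmult)
  qed
  have limQ: "(\<lambda>k. of_real (1 / c (\<sigma> k)) * f z - poly (smult (1 / c (\<sigma> k)) (P (\<sigma> k))) z) \<longlonglongrightarrow> u * f z - poly Q z" for z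
  proof -
    have *: "poly (smult (1 / c (\<sigma> k)) (P (\<sigma> k))) z = (\<Sum>j\<le>n. coeff (P (\<sigma> k)) j / c (\<sigma> k) * z ^ j)" for k
      by (simp add: poly_sum sum_divide_distrib)
    then show ?thesis
      unfolding polyQ * by (intro tendsto_diff tendsto_mult tendsto_sum tendsto_const u a) auto
  qed
  \<comment> \<open>If the scale tended to 0, the limit \<open>Q\<close> would have norm zero and
    vanish, although the scale and the moduli of the normalised coefficients always sum to
    1.\<close>
  have u0: "u \<noteq> 0"
  proof
    assume "u = 0"
    have inv0: "(\<lambda>k. 1 / c (\<sigma> k)) \<longlonglongrightarrow> 0"
      using u unfolding \<open>u = 0\<close> by (metis of_real_0 tendsto_of_real_iff)
    have "(\<lambda>k. ennreal ((1 / c (\<sigma> k)) powr p * B)) \<longlonglongrightarrow> ennreal (0 powr p * B)"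
      using p c1 by (intro tendsto_ennrealI tendsto_mult tendsto_powr' inv0 tendsto_const)
        (auto intro!: always_eventually simp: order_trans[OF zero_le_one])
    then have "liminf (\<lambda>k. ennreal ((1 / c (\<sigma> k)) powr p * B)) = 0"
      using p by (intro lim_imp_Liminf) auto
    moreover have "liminf (\<lambda>k. ennreal ((1 / c (\<sigma> k)) powr p) * I (P (\<sigma> k))) \<le> liminf (\<lambda>k. ennreal ((1 / c (\<sigma> k)) powr p * B))"
    proof (intro Liminf_mono always_eventually allI)
      fix k
      show "ennreal ((1 / c (\<sigma> k)) powr p) * I (P (\<sigma> k)) \<le> ennreal ((1 / c (\<sigma> k)) powr p * B)"
        using mult_left_mono[OF IB[of "\<sigma> k"]] by (simp add: ennreal_mult')
    qed
    ultimately have "(\<integral>\<^sup>+z. ennreal (cmod (poly Q z) powr p) \<partial>disc_measure \<alpha>) = 0"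
      using fatou[OF limQ] unfolding scaled by (simp add: \<open>u = 0\<close>)
    then have "Q = 0" by (rule nn_integral_disc_measure_eq_0_poly[OF \<alpha>])
    then have a0: "a j = 0" if "j \<le> n" for j using coeffQ[OF that] by simp
    have "(\<lambda>k. 1 / c (\<sigma> k) + (\<Sum>j\<le>n. cmod (coeff (P (\<sigma> k)) j / c (\<sigma> k)))) \<longlonglongrightarrow> 0 + (\<Sum>j\<le>n. cmod (0::complex))"
      using a a0 by (intro tendsto_add inv0 tendsto_sum tendsto_norm) auto
    moreover have "1 / c (\<sigma> k) + (\<Sum>j\<le>n. cmod (coeff (P (\<sigma> k)) j / c (\<sigma> k))) = 1" for k
    proof -
      have "1 / c (\<sigma> k) + (\<Sum>j\<le>n. cmod (coeff (P (\<sigma> k)) j / c (\<sigma> k))) = c (\<sigma> k) / c (\<sigma> k)"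
        using c1[of "\<sigma> k"] by (subst (3) c_def) (simp add: norm_divide sum_divide_distrib add_divide_distrib)
      then show ?thesis using c1[of "\<sigma> k"] by simp
    qed
    ultimately show False by (simp add: LIMSEQ_const_iff)
  qed
  \<comment> \<open>Dividing by \<open>u\<close> undoes the normalisation in the limit, so the
    coefficients of the minimising polynomials themselves converge along the subsequence.\<close>
  define R where "R = smult (1 / u) Q"
  have limP: "(\<lambda>k. coeff (P (\<sigma> k)) j) \<longlonglongrightarrow> a j / u" if "j \<le> n" for j
  proof -
    have "(\<lambda>k. (coeff (P (\<sigma> k)) j / c (\<sigma> k)) / of_real (1 / c (\<sigma> k))) \<longlonglongrightarrow> a j / u"
      using u0 by (intro tendsto_divide a u that)
    moreover have "(coeff (P (\<sigma> k)) j / c (\<sigma> k)) / of_real (1 / c (\<sigma> k)) = coeff (P (\<sigma> k)) j" for k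
      using c1[of "\<sigma> k"] by (simp add: field_simps)
    ultimately show ?thesis by simp
  qed
  have "(\<lambda>k. 1 * f z - poly (P (\<sigma> k)) z) \<longlonglongrightarrow> f z - poly R z" for z
  proof -
    have *: "poly R z = (\<Sum>j\<le>n. a j / u * z ^ j)"
      by (simp add: R_def polyQ sum_divide_distrib)
    show ?thesis
      unfolding poly_sum * mult_1 by (intro tendsto_diff tendsto_mult tendsto_sum tendsto_const limP) auto
  qed
  from fatou[OF this] have "I R \<le> liminf (\<lambda>k. I (P (\<sigma> k)))"
    by (simp add: I_def)
  also have "\<dots> \<le> liminf (\<lambda>k. \<iota> + ennreal (1 / real (Suc (\<sigma> k))))"
    by (intro Liminf_mono always_eventually allI P)
  also have "\<dots> = \<iota> + ennreal 0"
    using LIMSEQ_subseq_LIMSEQ[OF LIMSEQ_inverse_real_of_nat \<sigma>]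
    by (intro lim_imp_Liminf tendsto_add tendsto_const tendsto_ennrealI)
       (auto simp: o_def inverse_eq_divide)
  finally have "I R \<le> \<iota>" by simp
  moreover have "degree R \<le> n"
    using degQ by (simp add: R_def)
  ultimately show ?thesis
    using \<iota>_le order_trans by blast
qed

section \<open>The iterated integrals of the kernel\<close>

text \<open>The derivative is required on the open ray only and the endpoint enters as a one-sided
  limit. At 0, division by zero gives \<open>H_fun 0\<close> the value 0, while its limit there is
  3/4.\<close>

lemma set_lebesgue_integral_FTC_Ici:
  fixes F f :: "real \<Rightarrow> 'a::euclidean_space"
  assumes F: "\<And>x. t < x \<Longrightarrow> (F has_vector_derivative f x) (at x)"
    and f: "\<And>x. t < x \<Longrightarrow> isCont f x"
    and int: "set_integrable lborel {t..} f"
    and A: "(F \<longlongrightarrow> A) (at_right t)" and B: "(F \<longlongrightarrow> B) at_top"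
  shows "(LBINT x:{t..}. f x) = B - A"
proof -
  have "(LBINT x:{t..}. f x) = (LBINT x:{t<..}. f x)"
    unfolding set_lebesgue_integral_def
  proof (rule integral_cong_AE)
    show "(\<lambda>x. indicator {t..} x *\<^sub>R f x) \<in> borel_measurable lborel"
      using int by (auto simp: set_integrable_def)
    have "set_integrable lborel {t<..} f" by (rule set_integrable_subset[OF int]) auto
    then show "(\<lambda>x. indicator {t<..} x *\<^sub>R f x) \<in> borel_measurable lborel"
      by (auto simp: set_integrable_def)
    show "AE x in lborel. indicator {t..} x *\<^sub>R f x = indicator {t<..} x *\<^sub>R f x"
      using AE_lborel_singleton[of t] by eventually_elim (auto simp: indicator_def)
  qed
  also have "\<dots> = (LBINT x=t..\<infinity>. f x)"
    by (simp add: interval_lebesgue_integral_def)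
  also have "\<dots> = B - A"
  proof (rule interval_integral_FTC_integrable[where F = F])
    show "set_integrable lborel (einterval (ereal t) \<infinity>) f"
      by (rule set_integrable_subset[OF int]) (auto simp: einterval_def)
    show "((F \<circ> real_of_ereal) \<longlongrightarrow> A) (at_right (ereal t))"
      using A by (simp add: ereal_tendsto_simps)
    show "((F \<circ> real_of_ereal) \<longlongrightarrow> B) (at_left \<infinity>)"
      using B by (simp add: ereal_tendsto_simps)
  qed (use F f in auto)
  finally show ?thesis .
qed

text \<open>For a nonnegative integrand the fundamental theorem yields integrability together with
  the value, so integrability need not be known beforehand.\<close>

lemma has_bochner_integral_FTC_Ici_nonneg:
  fixes F f :: "real \<Rightarrow> real"
  assumes f: "f \<in> borel_measurable borel"
    and F: "\<And>x. a \<le> x \<Longrightarrow> (F has_real_derivative f x) (at x)"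
    and nonneg: "\<And>x. a \<le> x \<Longrightarrow> 0 \<le> f x" and lim: "(F \<longlongrightarrow> T) at_top"
  shows "has_bochner_integral lborel (\<lambda>x. indicator {a..} x *\<^sub>R f x) (T - F a)"
proof (rule has_bochner_integral_nn_integral)
  have "F a \<le> F x" if "a \<le> x" for x
    using F nonneg that by (intro DERIV_nonneg_imp_nondecreasing[of a x F]) (auto intro: order_trans)
  then show "0 \<le> T - F a"
    using tendsto_lowerbound[OF lim, of "F a"] by (auto simp: eventually_at_top_linorder)
  have "(\<integral>\<^sup>+x. ennreal (indicator {a..} x *\<^sub>R f x) \<partial>lborel) = (\<integral>\<^sup>+x. ennreal (f x) * indicator {a..} x \<partial>lborel)"
    by (intro nn_integral_cong) (auto simp: indicator_def)
  also have "\<dots> = T - F a"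
    using assms by (rule nn_integral_FTC_atLeast)
  finally show "(\<integral>\<^sup>+x. ennreal (indicator {a..} x *\<^sub>R f x) \<partial>lborel) = ennreal (T - F a)" .
qed (use f nonneg in \<open>auto simp: indicator_def\<close>)

lemma set_integrable_inverse_square:
  assumes "0 < t"
  shows "set_integrable lborel {t..} (\<lambda>x::real. 1 / x\<^sup>2)"
proof -
  have "has_bochner_integral lborel (\<lambda>x. indicator {t..} x *\<^sub>R (1 / x\<^sup>2)) (0 - (- 1 / t))"
  proof (rule has_bochner_integral_FTC_Ici_nonneg)
    fix x assume "t \<le> x"
    then show "((\<lambda>x. - 1 / x) has_real_derivative 1 / x\<^sup>2) (at x)"
      using assms by (auto intro!: derivative_eq_intros simp: power2_eq_square)
  next
    show "((\<lambda>x::real. - 1 / x) \<longlongrightarrow> 0) at_top" by real_asymp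
  qed auto
  then show ?thesis by (auto simp: set_integrable_def has_bochner_integral_iff)
qed

section \<open>Laplace representation and decay of the iterated integrals\<close>

lemma has_bochner_integral_laplace_id:
  assumes t: "0 < t"
  shows "has_bochner_integral lborel (\<lambda>s. indicator {0..} s *\<^sub>R (s * exp (- s * t))) (1 / t\<^sup>2 :: real)"
proof -
  have "has_bochner_integral lborel (\<lambda>s. indicator {0..} s *\<^sub>R (s * exp (- s * t)))
      (0 - (\<lambda>s. - (s / t + 1 / t\<^sup>2) * exp (- s * t)) (0::real))"
  proof (rule has_bochner_integral_FTC_Ici_nonneg)
    fix s :: real
    show "((\<lambda>s. - (s / t + 1 / t\<^sup>2) * exp (- s * t)) has_real_derivative s * exp (- s * t)) (at s)"
      using t by (auto intro!: derivative_eq_intros simp: field_simps power2_eq_square)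
  next
    show "((\<lambda>s. - (s / t + 1 / t\<^sup>2) * exp (- s * t)) \<longlongrightarrow> 0) at_top"
      using t by real_asymp
  qed auto
  then show ?thesis by simp
qed

text \<open>Since \<open>1/t\<^sup>2 = \<integral> s e\<^sup>-\<^sup>s\<^sup>t ds\<close>, each \<open>H\<^sub>k\<close> is a Laplace integral in which every
  integration over \<open>[t, \<infinity>)\<close> divides by \<open>s - ia\<close>, of modulus at least 1. So the
  \<open>t\<^sup>-\<^sup>2\<close> decay survives all the iterated integrations.\<close>

definition laplace_integrand :: "nat \<Rightarrow> real \<Rightarrow> real \<Rightarrow> real \<Rightarrow> complex" where
  "laplace_integrand k a t s = of_real s * exp (- Complex s (- a) * of_real t) / Complex s (- a) ^ k"

definition laplace_kernel :: "nat \<Rightarrow> real \<Rightarrow> real \<Rightarrow> complex" where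
  "laplace_kernel k a t = (LBINT s:{0..}. laplace_integrand k a t s)"

lemma laplace_integrand_measurable [measurable]:
  "(\<lambda>(t, s). laplace_integrand k a t s) \<in> borel_measurable (borel \<Otimes>\<^sub>M borel)"
  unfolding laplace_integrand_def Complex_eq case_prod_beta' by measurable

lemma norm_laplace_integrand_le:
  assumes "1 \<le> a" "0 \<le> s"
  shows "cmod (laplace_integrand k a t s) \<le> s * exp (- s * t)"
proof -
  have "1 \<le> cmod (Complex s (- a))"
    using abs_Im_le_cmod[of "Complex s (- a)"] assms by simp
  then have "1 \<le> cmod (Complex s (- a)) ^ k" by (rule one_le_power)
  moreover have "cmod (laplace_integrand k a t s) = s * exp (- s * t) / cmod (Complex s (- a)) ^ k"
    using assms by (simp add: laplace_integrand_def norm_mult norm_divide norm_power)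
  moreover have "s * exp (- s * t) * 1 \<le> s * exp (- s * t) * cmod (Complex s (- a)) ^ k"
    using assms calculation(1) by (intro mult_left_mono) auto
  ultimately show ?thesis
    by (simp add: divide_le_eq)
qed

lemma
  assumes a: "1 \<le> a" and t: "0 < t"
  shows set_integrable_laplace_integrand: "set_integrable lborel {0..} (laplace_integrand k a t)"
    and integral_norm_laplace_integrand_le: "(LBINT s:{0..}. cmod (laplace_integrand k a t s)) \<le> 1 / t\<^sup>2"
proof -
  note L = has_bochner_integral_laplace_id[OF t]
  show *: "set_integrable lborel {0..} (laplace_integrand k a t)"
    unfolding set_integrable_def
    by (rule Bochner_Integration.integrable_bound[OF integrable.intros[OF L]])
       (use norm_laplace_integrand_le[OF a] in \<open>auto simp: indicator_def\<close>)
  have "(LBINT s:{0..}. cmod (laplace_integrand k a t s)) \<le> (LBINT s:{0..}. s * exp (- s * t))"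
    using L by (intro set_integral_mono set_integrable_norm * norm_laplace_integrand_le[OF a])
       (auto simp: set_integrable_def has_bochner_integral_iff)
  also have "\<dots> = 1 / t\<^sup>2"
    using L by (simp add: set_lebesgue_integral_def has_bochner_integral_iff)
  finally show "(LBINT s:{0..}. cmod (laplace_integrand k a t s)) \<le> 1 / t\<^sup>2" .
qed

lemma norm_laplace_kernel_le:
  assumes "1 \<le> a" "0 < t"
  shows "cmod (laplace_kernel k a t) \<le> 1 / t\<^sup>2"
proof -
  have "cmod (laplace_kernel k a t) \<le> (LBINT s:{0..}. cmod (laplace_integrand k a t s))"
    unfolding laplace_kernel_def by (rule set_integral_norm_bound[OF set_integrable_laplace_integrand[OF assms]])
  also have "\<dots> \<le> 1 / t\<^sup>2" by (rule integral_norm_laplace_integrand_le[OF assms])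
  finally show ?thesis .
qed

lemma laplace_kernel_0:
  assumes "0 < t"
  shows "laplace_kernel 0 a t = cis (a * t) / of_real (t\<^sup>2)"
proof -
  have "laplace_integrand 0 a t s = of_real (s * exp (- s * t)) * cis (a * t)" for s
  proof -
    have *: "- Complex s (- a) * of_real t = of_real (- s * t) + \<i> * of_real (a * t)"
      by (simp add: complex_eq_iff)
    show ?thesis
      unfolding laplace_integrand_def * exp_add cis_conv_exp exp_of_real by simp
  qed
  then have "laplace_kernel 0 a t = (LBINT s. complex_of_real (indicator {0..} s *\<^sub>R (s * exp (- s * t))) * cis (a * t))"
    by (simp add: laplace_kernel_def set_lebesgue_integral_def scaleR_conv_of_real mult.assoc)
  also have "\<dots> = complex_of_real (1 / t\<^sup>2) * cis (a * t)"
    using has_bochner_integral_laplace_id[OF assms]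
    by (simp only: integral_mult_left_zero integral_complex_of_real has_bochner_integral_iff)
  finally show ?thesis by simp
qed

text \<open>Fubini, justified by the bound 1/x^2 for the inner integral of the norm. Integrating the
  exponential in x then raises the power of s - ia by one.\<close>

lemma laplace_kernel_Suc:
  assumes a: "1 \<le> a" and t: "0 < t"
  shows "set_integrable lborel {t..} (laplace_kernel k a)"
    and "(LBINT x:{t..}. laplace_kernel k a x) = laplace_kernel (Suc k) a t"
proof -
  define f where "f = (\<lambda>(x, s). indicator {t..} x *\<^sub>R indicator {0..} s *\<^sub>R laplace_integrand k a x s)"
  have f_eq: "(\<integral>s. f (x, s) \<partial>lborel) = indicator {t..} x *\<^sub>R laplace_kernel k a x" for x
    by (simp add: f_def laplace_kernel_def set_lebesgue_integral_def del: scaleR_scaleR)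
  have fi: "integrable (lborel \<Otimes>\<^sub>M lborel) f"
  proof (rule lborel_pair.Fubini_integrable)
    show "f \<in> borel_measurable (lborel \<Otimes>\<^sub>M lborel)"
      unfolding f_def by measurable
    show "integrable lborel (\<lambda>x. \<integral>s. norm (f (x, s)) \<partial>lborel)"
    proof (rule Bochner_Integration.integrable_bound)
      show "integrable lborel (\<lambda>x. indicator {t..} x *\<^sub>R (1 / x\<^sup>2))"
        using set_integrable_inverse_square[OF t] by (simp add: set_integrable_def)
      show "(\<lambda>x. \<integral>s. norm (f (x, s)) \<partial>lborel) \<in> borel_measurable lborel"
        unfolding f_def by measurable
      show "AE x in lborel. norm (\<integral>s. norm (f (x, s)) \<partial>lborel) \<le> norm (indicator {t..} x *\<^sub>R (1 / x\<^sup>2))"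
      proof (rule AE_I2)
        fix x
        show "norm (\<integral>s. norm (f (x, s)) \<partial>lborel) \<le> norm (indicator {t..} x *\<^sub>R (1 / x\<^sup>2))"
          using integral_norm_laplace_integrand_le[OF a, of x k] t
          by (cases "t \<le> x") (auto simp: f_def set_lebesgue_integral_def)
      qed
    qed
    show "AE x in lborel. integrable lborel (\<lambda>s. f (x, s))"
    proof (rule AE_I2)
      fix x
      show "integrable lborel (\<lambda>s. f (x, s))"
        using set_integrable_laplace_integrand[OF a, of x k] t
        by (cases "t \<le> x") (auto simp: f_def set_integrable_def)
    qed
  qed
  have "integrable lborel (\<lambda>x. \<integral>s. f (x, s) \<partial>lborel)"
    using lborel_pair.integrable_fst'[OF fi] .
  then show "set_integrable lborel {t..} (laplace_kernel k a)"
    by (simp add: f_eq set_integrable_def)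
  \<comment> \<open>For s = 0 the exponential does not decay; there the factor s makes both sides
    vanish, which is settled at the end.\<close>
  have inner: "(LBINT x:{t..}. laplace_integrand k a x s) = laplace_integrand (Suc k) a t s" if s: "0 < s" for s
  proof -
    let ?w = "Complex s (- a)"
    have w: "?w \<noteq> 0" using a by (simp add: complex_eq_iff)
    have eqF: "laplace_integrand (Suc k) a x s = (of_real s / ?w ^ Suc k) * exp (- ?w * of_real x)" for x
      by (simp add: laplace_integrand_def)
    have eqf: "laplace_integrand k a x s = (of_real s / ?w ^ k) * exp (- ?w * of_real x)" for x
      by (simp add: laplace_integrand_def)
    have "(LBINT x:{t..}. laplace_integrand k a x s) = 0 - (- laplace_integrand (Suc k) a t s)"
    proof (rule set_lebesgue_integral_FTC_Ici)
      fix x :: real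
      have "((\<lambda>x. - laplace_integrand (Suc k) a x s) has_vector_derivative
           - ((of_real s / ?w ^ Suc k) * (- ?w * exp (- ?w * of_real x)))) (at x)"
        unfolding eqF
        by (rule has_vector_derivative_real_field) (auto intro!: derivative_eq_intros)
      also have "- ((of_real s / ?w ^ Suc k) * (- ?w * exp (- ?w * of_real x))) = laplace_integrand k a x s"
        using w by (simp add: eqf)
      finally show "((\<lambda>x. - laplace_integrand (Suc k) a x s) has_vector_derivative laplace_integrand k a x s) (at x)" .
      show "isCont (\<lambda>x. laplace_integrand k a x s) x"
        unfolding eqf by (intro continuous_intros)
    next
      show "set_integrable lborel {t..} (\<lambda>x. laplace_integrand k a x s)"
        unfolding set_integrable_def
      proof (rule Bochner_Integration.integrable_bound)
        show "integrable lborel (\<lambda>x. s * (indicator {t..} x *\<^sub>R exp (- (x * s))))"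
        proof (rule integrable_mult_right)
          have "set_integrable lborel {t..} (\<lambda>x. exp (- (x * s)))"
            by (rule set_integrable_subset[OF integrable_I0i_exp_mscale[OF s]]) (use t in auto)
          then show "integrable lborel (\<lambda>x. indicator {t..} x *\<^sub>R exp (- (x * s)))"
            by (simp only: set_integrable_def)
        qed
        show "AE x in lborel. norm (indicator {t..} x *\<^sub>R laplace_integrand k a x s) \<le> norm (s * (indicator {t..} x *\<^sub>R exp (- (x * s))))"
          using norm_laplace_integrand_le[OF a, of s k] s by (auto simp: indicator_def mult.commute)
      qed (unfold eqf, measurable)
      have "isCont (\<lambda>x. - laplace_integrand (Suc k) a x s) t"
        unfolding eqF by (intro continuous_intros)
      then show "((\<lambda>x. - laplace_integrand (Suc k) a x s) \<longlongrightarrow> - laplace_integrand (Suc k) a t s) (at_right t)"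
        by (simp add: isCont_def filterlim_at_split)
      show "((\<lambda>x. - laplace_integrand (Suc k) a x s) \<longlongrightarrow> 0) at_top"
      proof (rule Lim_null_comparison)
        show "\<forall>\<^sub>F x in at_top. norm (- laplace_integrand (Suc k) a x s) \<le> s * exp (- s * x)"
          using norm_laplace_integrand_le[OF a, of s "Suc k"] s by simp
        show "((\<lambda>x. s * exp (- s * x)) \<longlongrightarrow> 0) at_top" using s by real_asymp
      qed
    qed
    then show ?thesis by simp
  qed
  have "(LBINT x:{t..}. laplace_kernel k a x) = (\<integral>x. \<integral>s. f (x, s) \<partial>lborel \<partial>lborel)"
    by (simp add: f_eq set_lebesgue_integral_def)
  also have "\<dots> = (\<integral>s. \<integral>x. f (x, s) \<partial>lborel \<partial>lborel)"
    using lborel_pair.Fubini_integral[of "\<lambda>x s. f (x, s)"] fi by simp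
  also have "\<dots> = (\<integral>s. indicator {0..} s *\<^sub>R (LBINT x:{t..}. laplace_integrand k a x s) \<partial>lborel)"
  proof (intro Bochner_Integration.integral_cong refl)
    fix s
    have "(\<lambda>x. f (x, s)) = (\<lambda>x. indicator {0..} s *\<^sub>R (indicator {t..} x *\<^sub>R laplace_integrand k a x s))"
      by (simp add: f_def mult.commute)
    then show "(\<integral>x. f (x, s) \<partial>lborel) = indicator {0..} s *\<^sub>R (LBINT x:{t..}. laplace_integrand k a x s)"
      by (simp only: set_lebesgue_integral_def integral_scaleR_right)
  qed
  also have "\<dots> = laplace_kernel (Suc k) a t"
    unfolding laplace_kernel_def set_lebesgue_integral_def[of _ "{0..}"]
  proof (intro Bochner_Integration.integral_cong refl)
    fix s :: real
    show "indicator {0..} s *\<^sub>R (LBINT x:{t..}. laplace_integrand k a x s) = indicator {0..} s *\<^sub>R laplace_integrand (Suc k) a t s"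
    proof (cases "0 < s")
      case True
      then show ?thesis by (simp add: inner)
    next
      case False
      then show ?thesis
        by (auto simp: indicator_def not_less laplace_integrand_def set_lebesgue_integral_def)
    qed
  qed
  finally show "(LBINT x:{t..}. laplace_kernel k a x) = laplace_kernel (Suc k) a t" .
qed

text \<open>The recursion for the kernels is linear, so it passes to the real part of their
  difference. Positive t supplies the damping that makes the Laplace integrals converge
  absolutely.\<close>

lemma H_fun_eq_laplace:
  assumes "0 < t"
  shows "H_fun k t = Re (laplace_kernel k 1 t - laplace_kernel k 2 t) / 2"
  using assms
proof (induction k arbitrary: t)
  case 0
  then show ?case by (simp add: laplace_kernel_0 h_fun_def field_simps)
next
  case (Suc k)
  have i: "set_integrable lborel {t..} (laplace_kernel k 1)" "set_integrable lborel {t..} (laplace_kernel k 2)"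
    using laplace_kernel_Suc(1)[OF _ Suc.prems] by auto
  have "H_fun (Suc k) t = (LBINT x:{t..}. Re (laplace_kernel k 1 x - laplace_kernel k 2 x) / 2)"
    unfolding H_fun.simps using Suc.prems
    by (intro set_lebesgue_integral_cong allI impI Suc.IH) auto
  also have "\<dots> = (LBINT x. Re (indicator {t..} x *\<^sub>R laplace_kernel k 1 x - indicator {t..} x *\<^sub>R laplace_kernel k 2 x) / 2)"
    unfolding set_lebesgue_integral_def
    by (intro Bochner_Integration.integral_cong) (auto simp: indicator_def)
  also have "\<dots> = Re ((LBINT x:{t..}. laplace_kernel k 1 x) - (LBINT x:{t..}. laplace_kernel k 2 x)) / 2"
    using i unfolding set_integrable_def set_lebesgue_integral_def
    by (simp only: integral_divide_zero integral_Re Bochner_Integration.integral_diff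
        Bochner_Integration.integrable_diff)
  also have "\<dots> = Re (laplace_kernel (Suc k) 1 t - laplace_kernel (Suc k) 2 t) / 2"
    using laplace_kernel_Suc(2)[OF _ Suc.prems, of 1 k] laplace_kernel_Suc(2)[OF _ Suc.prems, of 2 k] by simp
  finally show ?case .
qed

text \<open>Half the difference of two terms of size 1/t^2, hence one constant for all
  \<open>k\<close>. This disposes of the boundary terms at infinity.\<close>

lemma abs_H_fun_le:
  assumes "0 < t"
  shows "\<bar>H_fun k t\<bar> \<le> 1 / t\<^sup>2"
proof -
  have "\<bar>H_fun k t\<bar> \<le> cmod (laplace_kernel k 1 t - laplace_kernel k 2 t) / 2"
    using abs_Re_le_cmod[of "laplace_kernel k 1 t - laplace_kernel k 2 t"] by (simp add: H_fun_eq_laplace[OF assms])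
  also have "\<dots> \<le> (cmod (laplace_kernel k 1 t) + cmod (laplace_kernel k 2 t)) / 2"
    by (simp add: norm_triangle_ineq4)
  also have "\<dots> \<le> (1 / t\<^sup>2 + 1 / t\<^sup>2) / 2"
    using assms by (intro divide_right_mono add_mono norm_laplace_kernel_le) auto
  finally show ?thesis by simp
qed

lemma set_integrable_H_fun_Ici_pos:
  assumes "0 < t"
  shows "set_integrable lborel {t..} (H_fun k)"
proof -
  have "set_integrable lborel {t..} (\<lambda>x. Re (laplace_kernel k 1 x - laplace_kernel k 2 x) / 2)"
  proof -
    have "integrable lborel (\<lambda>x. Re (indicator {t..} x *\<^sub>R laplace_kernel k 1 x - indicator {t..} x *\<^sub>R laplace_kernel k 2 x) / 2)"
      using laplace_kernel_Suc(1)[OF _ assms, of 1 k] laplace_kernel_Suc(1)[OF _ assms, of 2 k]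
      unfolding set_integrable_def by (intro integrable_divide_zero integrable_Re Bochner_Integration.integrable_diff) auto
    also have "(\<lambda>x. Re (indicator {t..} x *\<^sub>R laplace_kernel k 1 x - indicator {t..} x *\<^sub>R laplace_kernel k 2 x) / 2)
        = (\<lambda>x. indicator {t..} x *\<^sub>R (Re (laplace_kernel k 1 x - laplace_kernel k 2 x) / 2))"
      by (auto simp: indicator_def)
    finally show ?thesis
      by (simp add: set_integrable_def)
  qed
  then show ?thesis
    by (rule set_integrable_cong[THEN iffD1, rotated -1]) (use assms in \<open>auto simp: H_fun_eq_laplace\<close>)
qed

section \<open>The cosine transform of \<open>H_fun 0\<close>\<close>

lemma set_integrable_bounded_decay:
  fixes f :: "real \<Rightarrow> real"
  assumes f: "f \<in> borel_measurable borel"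
    and near: "\<And>t. 0 \<le> t \<Longrightarrow> t \<le> 1 \<Longrightarrow> \<bar>f t\<bar> \<le> C" and far: "\<And>t. 1 \<le> t \<Longrightarrow> \<bar>f t\<bar> \<le> C / t\<^sup>2"
  shows "set_integrable lborel {0..} f"
proof -
  have C: "0 \<le> C" using near[of 0] abs_ge_zero[of "f 0"] by linarith
  have "set_integrable lborel ({0..1} \<union> {1..}) f"
  proof (rule set_integrable_Un)
    have "set_integrable lborel {0..1::real} (\<lambda>_. C)"
      by (simp add: set_integrable_def)
    then show "set_integrable lborel {0..1} f"
      by (rule set_integrable_bound) (use f near C in \<open>auto simp: set_borel_measurable_def\<close>)
    have "set_integrable lborel {1..} (\<lambda>t::real. C * (1 / t\<^sup>2))"
      by (intro set_integrable_mult_right set_integrable_inverse_square) simp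
    then show "set_integrable lborel {1..} f"
      by (rule set_integrable_bound) (use f far C in \<open>auto simp: set_borel_measurable_def\<close>)
  qed auto
  also have "{0..1} \<union> {1..} = {0::real..}" by auto
  finally show ?thesis .
qed

lemma one_minus_cos_le: "1 - cos y \<le> y\<^sup>2 / 2" for y :: real
proof -
  have "1 - cos y = 2 * (sin (y / 2))\<^sup>2"
    using cos_double_sin[of "y / 2"] by simp
  also have "\<bar>sin (y / 2)\<bar>\<^sup>2 \<le> \<bar>y / 2\<bar>\<^sup>2"
    by (intro power_mono abs_sin_x_le_abs_x) auto
  then have "2 * (sin (y / 2))\<^sup>2 \<le> y\<^sup>2 / 2" by (simp add: power_divide)
  finally show ?thesis .
qed

lemma set_integrable_one_minus_cos: "set_integrable lborel {0..} (\<lambda>t::real. (1 - cos (a * t)) / t\<^sup>2)"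
proof (rule set_integrable_bounded_decay)
  fix t :: real
  have nonneg: "0 \<le> 1 - cos (a * t)" by simp
  show "\<bar>(1 - cos (a * t)) / t\<^sup>2\<bar> \<le> a\<^sup>2 / 2 + 2"
  proof (cases "t = 0")
    case False
    have "(1 - cos (a * t)) / t\<^sup>2 \<le> ((a * t)\<^sup>2 / 2) / t\<^sup>2"
      by (intro divide_right_mono one_minus_cos_le) auto
    also have "\<dots> = a\<^sup>2 / 2" using False by (simp add: power_mult_distrib)
    finally have "(1 - cos (a * t)) / t\<^sup>2 \<le> a\<^sup>2 / 2" .
    moreover have "0 \<le> (1 - cos (a * t)) / t\<^sup>2" using nonneg by (intro divide_nonneg_nonneg) auto
    ultimately show ?thesis by linarith
  qed simp
  have "1 - cos (a * t) \<le> 2" using cos_ge_minus_one[of "a * t"] by linarith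
  then have "1 - cos (a * t) \<le> a\<^sup>2 / 2 + 2" by (simp add: add_increasing)
  then show "\<bar>(1 - cos (a * t)) / t\<^sup>2\<bar> \<le> (a\<^sup>2 / 2 + 2) / t\<^sup>2"
    using nonneg by (simp only: abs_divide abs_of_nonneg abs_power2 divide_right_mono zero_le_power2)
qed measurable

text \<open>Integration by parts leads to the sine integral: the antiderivative a Si(at) - (1 -
  cos(at))/t tends to 0 at the origin and to a pi/2 at infinity.\<close>

lemma one_minus_cos_integral_pos:
  assumes a: "0 < a"
  shows "(LBINT t:{0..}. (1 - cos (a * t)) / t\<^sup>2) = pi * a / 2"
proof -
  have "(LBINT t:{0..}. (1 - cos (a * t)) / t\<^sup>2) = a * (pi / 2) - 0"
  proof (rule set_lebesgue_integral_FTC_Ici[where F = "\<lambda>t. a * Si (a * t) - (1 - cos (a * t)) / t"])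
    fix x :: real assume x: "0 < x"
    have "((\<lambda>t. a * Si (a * t) - (1 - cos (a * t)) / t) has_real_derivative (1 - cos (a * x)) / x\<^sup>2) (at x)"
      using a x by (auto intro!: derivative_eq_intros DERIV_chain2[OF DERIV_Si] simp: field_simps power2_eq_square)
    then show "((\<lambda>t. a * Si (a * t) - (1 - cos (a * t)) / t) has_vector_derivative (1 - cos (a * x)) / x\<^sup>2) (at x)"
      by (simp add: has_real_derivative_iff_has_vector_derivative)
    show "isCont (\<lambda>t. (1 - cos (a * t)) / t\<^sup>2) x"
      using x by (auto intro!: continuous_intros)
  next
    show "set_integrable lborel {0..} (\<lambda>t. (1 - cos (a * t)) / t\<^sup>2)"
      by (rule set_integrable_one_minus_cos)
    have "isCont (\<lambda>t. a * Si (a * t)) 0"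
      by (intro continuous_intros isCont_o2[OF _ isCont_Si])
    then have "((\<lambda>t. a * Si (a * t)) \<longlongrightarrow> a * Si (a * 0)) (at_right 0)"
      unfolding isCont_def by (rule filterlim_mono) (auto simp: at_le)
    moreover have "Si 0 = 0" using Si_neg[of 0] by simp
    moreover have "((\<lambda>t. (1 - cos (a * t)) / t) \<longlongrightarrow> 0) (at_right 0)"
      using a by real_asymp
    ultimately show "((\<lambda>t. a * Si (a * t) - (1 - cos (a * t)) / t) \<longlongrightarrow> 0) (at_right 0)"
      using tendsto_diff by fastforce
    have "((\<lambda>t. Si (a * t)) \<longlongrightarrow> pi / 2) at_top"
      by (rule filterlim_compose[OF Si_at_top]) (use a in real_asymp)
    moreover have "((\<lambda>t. (1 - cos (a * t)) / t) \<longlongrightarrow> 0) at_top"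
      by real_asymp
    ultimately show "((\<lambda>t. a * Si (a * t) - (1 - cos (a * t)) / t) \<longlongrightarrow> a * (pi / 2)) at_top"
      using tendsto_diff[OF tendsto_mult[OF tendsto_const]] by fastforce
  qed
  then show ?thesis by simp
qed

lemma one_minus_cos_integral: "(LBINT t:{0..}. (1 - cos (a * t)) / t\<^sup>2) = pi * \<bar>a\<bar> / 2"
proof (cases "a = 0")
  case False
  have "cos (a * t) = cos (\<bar>a\<bar> * t)" for t by (simp add: abs_if)
  then show ?thesis using one_minus_cos_integral_pos[of "\<bar>a\<bar>"] False by simp
qed (simp add: set_lebesgue_integral_def)

text \<open>The product formulas turn h(t) cos(xt) into four cosines. A single cosine over t^2 is
  not integrable at 0, but the four coefficients add up to zero, so 1 may be subtracted from each
  cosine.\<close>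

lemma
  shows set_integrable_H_fun_0_cos: "set_integrable lborel {0..} (\<lambda>t. H_fun 0 t * cos (x * t))"
    and H_fun_0_cos_integral: "(LBINT t:{0..}. H_fun 0 t * cos (x * t))
      = pi / 8 * (\<bar>2 + x\<bar> + \<bar>2 - x\<bar> - \<bar>1 + x\<bar> - \<bar>1 - x\<bar>)"
proof -
  let ?q = "\<lambda>a t::real. (1 - cos (a * t)) / t\<^sup>2"
  have eq: "(\<lambda>t. H_fun 0 t * cos (x * t)) = (\<lambda>t. 1 / 4 * (?q (2 + x) t + ?q (2 - x) t - ?q (1 + x) t - ?q (1 - x) t))"
  proof
    fix t
    have "cos t * cos (x * t) = (cos ((1 + x) * t) + cos ((1 - x) * t)) / 2"
      "cos (2 * t) * cos (x * t) = (cos ((2 + x) * t) + cos ((2 - x) * t)) / 2"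
      by (simp_all add: distrib_right left_diff_distrib cos_add cos_diff)
    moreover have "(cos t - cos (2 * t)) / 2 * cos (x * t) = (cos t * cos (x * t) - cos (2 * t) * cos (x * t)) / 2"
      by (simp add: left_diff_distrib)
    moreover have "((A + B) / 2 - (C + D) / 2) / 2 = 1 / 4 * ((1 - C) + (1 - D) - (1 - A) - (1 - B))" for A B C D :: real
      by (simp add: field_simps)
    ultimately have "(cos t - cos (2 * t)) / 2 * cos (x * t) =
        1 / 4 * ((1 - cos ((2 + x) * t)) + (1 - cos ((2 - x) * t)) - (1 - cos ((1 + x) * t)) - (1 - cos ((1 - x) * t)))"
      by (simp only:)
    then show "H_fun 0 t * cos (x * t) = 1 / 4 * (?q (2 + x) t + ?q (2 - x) t - ?q (1 + x) t - ?q (1 - x) t)"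
      by (simp only: H_fun.simps h_fun_def times_divide_eq_left times_divide_eq_right add_divide_distrib[symmetric] diff_divide_distrib[symmetric])
  qed
  have i: "set_integrable lborel {0..} (?q a)" for a by (rule set_integrable_one_minus_cos)
  show "set_integrable lborel {0..} (\<lambda>t. H_fun 0 t * cos (x * t))"
    unfolding eq by (intro set_integrable_mult_right set_integral_diff set_integral_add i)
  show "(LBINT t:{0..}. H_fun 0 t * cos (x * t))
      = pi / 8 * (\<bar>2 + x\<bar> + \<bar>2 - x\<bar> - \<bar>1 + x\<bar> - \<bar>1 - x\<bar>)"
    unfolding eq set_integral_mult_right
  proof -
    have "(LBINT t:{0..}. ?q (2 + x) t + ?q (2 - x) t - ?q (1 + x) t - ?q (1 - x) t)
        = pi * \<bar>2 + x\<bar> / 2 + pi * \<bar>2 - x\<bar> / 2 - pi * \<bar>1 + x\<bar> / 2 - pi * \<bar>1 - x\<bar> / 2"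
      by (simp only: set_integral_diff set_integral_add i one_minus_cos_integral)
    then show "1 / 4 * (LBINT t:{0..}. ?q (2 + x) t + ?q (2 - x) t - ?q (1 + x) t - ?q (1 - x) t)
        = pi / 8 * (\<bar>2 + x\<bar> + \<bar>2 - x\<bar> - \<bar>1 + x\<bar> - \<bar>1 - x\<bar>)"
      by (simp add: field_simps)
  qed
qed

section \<open>Continuity, integrability and derivatives of the iterated integrals\<close>

text \<open>Splitting the half-line at t. As a constant minus an indefinite integral, the tail
  integral is continuous up to 0 and its derivative on the open ray can be read off.\<close>

lemma H_fun_Suc_eq_integral:
  assumes int: "set_integrable lborel {0..} (H_fun k)" and t: "0 \<le> t"
  shows "H_fun (Suc k) t = H_fun (Suc k) 0 - integral {0..t} (H_fun k)"
proof -
  have sub: "set_integrable lborel {t..} (H_fun k)" "set_integrable lborel {0..t} (H_fun k)"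
    by (rule set_integrable_subset[OF int]; use t in auto)+
  have "H_fun (Suc k) 0 = integral ({0..t} \<union> {t..}) (H_fun k)"
  proof -
    have "{0..} = {0..t} \<union> {t..}" using t by auto
    then show ?thesis using set_borel_integral_eq_integral[OF int] by simp
  qed
  also have "\<dots> = integral {0..t} (H_fun k) + integral {t..} (H_fun k)"
  proof (rule Henstock_Kurzweil_Integration.integral_Un)
    have "{0..t} \<inter> {t..} = {t}" using t by auto
    then show "negligible ({0..t} \<inter> {t..})" by simp
  qed (use sub in \<open>auto intro: set_borel_integral_eq_integral\<close>)
  also have "integral {t..} (H_fun k) = H_fun (Suc k) t"
    using set_borel_integral_eq_integral(2)[OF sub(1)] by simp
  finally show ?thesis by simp
qed

lemma continuous_on_H_fun_Suc:
  assumes int: "set_integrable lborel {0..} (H_fun k)"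
  shows "continuous_on {0..b} (H_fun (Suc k))"
proof -
  have "set_integrable lborel {0..b} (H_fun k)"
    by (rule set_integrable_subset[OF int]) auto
  then have "continuous_on {0..b} (\<lambda>t. H_fun (Suc k) 0 - integral {0..t} (H_fun k))"
    by (intro continuous_intros indefinite_integral_continuous_1 set_borel_integral_eq_integral)
  then show ?thesis
    by (rule continuous_on_eq) (metis H_fun_Suc_eq_integral[OF int] atLeastAtMost_iff)
qed

text \<open>The Laplace estimate blows up at 0, so it serves on [1, infinity) only. On [0, 1]
  continuity takes over, which in turn rests on integrability of the preceding function; hence the
  induction.\<close>

lemma set_integrable_H_fun: "set_integrable lborel {0..} (H_fun k)"
proof (induction k)
  case 0
  then show ?case using set_integrable_H_fun_0_cos[of 0] by simp
next
  case (Suc k)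
  have "set_integrable lborel ({0..1} \<union> {1..}) (H_fun (Suc k))"
    by (intro set_integrable_Un borel_integrable_atLeastAtMost' continuous_on_H_fun_Suc Suc
        set_integrable_H_fun_Ici_pos) auto
  also have "{0..1} \<union> {1..} = {0::real..}" by auto
  finally show ?case .
qed

lemma isCont_H_fun:
  assumes "0 < t"
  shows "isCont (H_fun k) t"
proof (cases k)
  case 0
  then show ?thesis using assms unfolding 0 H_fun.simps h_fun_def by (auto intro!: continuous_intros)
next
  case (Suc l)
  have "continuous_on {0<..<t + 1} (H_fun (Suc l))"
    by (rule continuous_on_subset[OF continuous_on_H_fun_Suc[OF set_integrable_H_fun, of "t + 1"]]) auto
  then show ?thesis
    unfolding Suc by (rule continuous_on_interior) (use assms in auto)
qed

lemma has_vector_derivative_H_fun: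
  assumes t: "0 < t"
  shows "(H_fun (Suc k) has_vector_derivative - H_fun k t) (at t)"
proof -
  have "set_integrable lborel {0..t + 1} (H_fun k)"
    by (rule set_integrable_subset[OF set_integrable_H_fun]) auto
  then have "H_fun k integrable_on {0..t + 1}"
    by (rule set_borel_integral_eq_integral)
  then have "((\<lambda>u. integral {0..u} (H_fun k)) has_vector_derivative H_fun k t) (at t within {0..t + 1} - {})"
    using t by (intro integral_has_vector_derivative_continuous_at)
       (auto intro!: continuous_at_imp_continuous_at_within isCont_H_fun)
  then have "((\<lambda>u. integral {0..u} (H_fun k)) has_vector_derivative H_fun k t) (at t)"
    using t at_within_interior[of t "{0..t + 1}"] by (simp add: interior_atLeastAtMost_real)
  then have "((\<lambda>u. H_fun (Suc k) 0 - integral {0..u} (H_fun k)) has_vector_derivative 0 - H_fun k t) (at t)"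
    by (intro derivative_intros)
  then have "((\<lambda>u. H_fun (Suc k) 0 - integral {0..u} (H_fun k)) has_vector_derivative - H_fun k t) (at t)"
    by (simp only: diff_0)
  then show ?thesis
    by (rule has_vector_derivative_transform_within_open[where S = "{0<..}"])
       (use t in \<open>auto intro: H_fun_Suc_eq_integral[OF set_integrable_H_fun, symmetric] simp del: H_fun.simps\<close>)
qed

section \<open>Fourier transforms of the two-sided kernels\<close>

text \<open>A transform over the half-line, because the extension to the whole line may jump at 0;
  integration by parts then shows the jump as an explicit boundary value.\<close>

definition half_transform :: "nat \<Rightarrow> real \<Rightarrow> complex" where
  "half_transform k x = (LBINT t:{0..}. H_fun k t *\<^sub>R cis (x * t))"

lemma set_integrable_H_fun_cis: "set_integrable lborel {0..} (\<lambda>t. H_fun k t *\<^sub>R cis (x * t))"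
  unfolding set_integrable_def
proof (rule Bochner_Integration.integrable_bound)
  show "integrable lborel (\<lambda>t. indicator {0..} t *\<^sub>R H_fun k t)"
    using set_integrable_H_fun by (simp add: set_integrable_def)
  then have "(\<lambda>t. indicator {0..} t *\<^sub>R H_fun k t) \<in> borel_measurable lborel" by auto
  moreover have "(\<lambda>t. cis (x * t)) \<in> borel_measurable borel"
    by (intro borel_measurable_continuous_onI continuous_intros)
  then have "(\<lambda>t. cis (x * t)) \<in> borel_measurable lborel" by simp
  ultimately have "(\<lambda>t. (indicator {0..} t *\<^sub>R H_fun k t) *\<^sub>R cis (x * t)) \<in> borel_measurable lborel"
    by (rule borel_measurable_scaleR)
  then show "(\<lambda>t. indicator {0..} t *\<^sub>R (H_fun k t *\<^sub>R cis (x * t))) \<in> borel_measurable lborel"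
    by simp
qed auto

text \<open>Integration by parts over the half-line. The recurrence is kept free of division so that
  it also holds at x = 0, where it later determines boundary values.\<close>

lemma half_transform_Suc:
  "\<i> * of_real x * half_transform (Suc k) x = half_transform k x - of_real (H_fun (Suc k) 0)"
proof -
  let ?f = "\<lambda>t. - (H_fun k t *\<^sub>R cis (x * t)) + (\<i> * of_real x) * (H_fun (Suc k) t *\<^sub>R cis (x * t))"
  have cis': "((\<lambda>t. cis (x * t)) has_vector_derivative (\<i> * of_real x) * cis (x * t)) (at t)" for t
  proof -
    have "((\<lambda>z. exp (\<i> * (of_real x * z))) has_field_derivative (\<i> * of_real x) * exp (\<i> * (of_real x * of_real t))) (at (of_real t))"
      by (auto intro!: derivative_eq_intros)
    from has_vector_derivative_real_field[OF this] show ?thesis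
      by (simp add: cis_conv_exp)
  qed
  have neg: "set_integrable lborel {0..} (\<lambda>t. - (H_fun k t *\<^sub>R cis (x * t)))"
    using set_integrable_mult_right[OF set_integrable_H_fun_cis[of k x], of "-1"] by simp
  have contcis: "isCont (\<lambda>t. cis (x * t)) t" for t
  proof -
    have "continuous_on UNIV (\<lambda>t. cis (x * t))" by (intro continuous_intros)
    then show ?thesis by (simp add: continuous_on_eq_continuous_at)
  qed
  have "(LBINT t:{0..}. ?f t) = 0 - H_fun (Suc k) 0 *\<^sub>R 1"
  proof (rule set_lebesgue_integral_FTC_Ici[where F = "\<lambda>t. H_fun (Suc k) t *\<^sub>R cis (x * t)"])
    fix t :: real assume t: "0 < t"
    have "((\<lambda>t. H_fun (Suc k) t *\<^sub>R cis (x * t)) has_vector_derivative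
        (H_fun (Suc k) t *\<^sub>R ((\<i> * of_real x) * cis (x * t)) + (- H_fun k t) *\<^sub>R cis (x * t))) (at t)"
      using has_vector_derivative_H_fun[OF t, of k]
      by (intro has_vector_derivative_scaleR cis') (simp add: has_real_derivative_iff_has_vector_derivative)
    then show "((\<lambda>t. H_fun (Suc k) t *\<^sub>R cis (x * t)) has_vector_derivative ?f t) (at t)"
      by (simp add: algebra_simps del: H_fun.simps)
    show "isCont ?f t"
      using isCont_H_fun[OF t, of k] isCont_H_fun[OF t, of "Suc k"] contcis
      by (intro continuous_intros) 
  next
    show "set_integrable lborel {0..} ?f"
      by (intro set_integral_add set_integrable_mult_right neg set_integrable_H_fun_cis)
    have "continuous_on {0..1} (\<lambda>t. H_fun (Suc k) t *\<^sub>R cis (x * t))"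
      by (intro continuous_intros continuous_on_H_fun_Suc set_integrable_H_fun)
    then have "((\<lambda>t. H_fun (Suc k) t *\<^sub>R cis (x * t)) \<longlongrightarrow> H_fun (Suc k) 0 *\<^sub>R cis (x * 0)) (at_right 0)"
      by (rule continuous_on_Icc_at_rightD) simp
    then show "((\<lambda>t. H_fun (Suc k) t *\<^sub>R cis (x * t)) \<longlongrightarrow> H_fun (Suc k) 0 *\<^sub>R 1) (at_right 0)"
      by simp
    show "((\<lambda>t. H_fun (Suc k) t *\<^sub>R cis (x * t)) \<longlongrightarrow> 0) at_top"
    proof (rule Lim_null_comparison)
      show "\<forall>\<^sub>F t in at_top. norm (H_fun (Suc k) t *\<^sub>R cis (x * t)) \<le> 1 / t\<^sup>2"
        using eventually_gt_at_top[of 0] by eventually_elim (simp add: abs_H_fun_le del: H_fun.simps)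
      show "((\<lambda>t::real. 1 / t\<^sup>2) \<longlongrightarrow> 0) at_top" by real_asymp
    qed
  qed
  also have "(LBINT t:{0..}. ?f t) = - half_transform k x + \<i> * of_real x * half_transform (Suc k) x"
    unfolding half_transform_def
    by (simp only: set_integral_add(2)[OF neg set_integrable_mult_right[OF set_integrable_H_fun_cis]]
        set_integral_uminus[OF set_integrable_H_fun_cis] set_integral_mult_right)
  finally show ?thesis by (simp add: scaleR_conv_of_real algebra_simps del: H_fun.simps)
qed

lemma lborel_reflect:
  fixes f :: "real \<Rightarrow> 'a::{banach, second_countable_topology}"
  assumes "integrable lborel f"
  shows "integrable lborel (\<lambda>t. f (- t))" and "(\<integral>t. f (- t) \<partial>lborel) = (\<integral>t. f t \<partial>lborel)"
  using assms lborel_integrable_real_affine[of f "-1" 0] lborel_integral_real_affine[of "-1" f 0] by simp_all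

text \<open>The sign alternates because integration by parts exchanges even and odd functions. Both
  summands count the point t = 0, a null set.\<close>

definition two_sided_kernel :: "nat \<Rightarrow> real \<Rightarrow> real" where
  "two_sided_kernel k t = indicator {0..} t * H_fun k t + (-1) ^ k * (indicator {0..} (- t) * H_fun k (- t))"

definition kernel_transform :: "nat \<Rightarrow> real \<Rightarrow> complex" where
  "kernel_transform k x = (\<integral>t. two_sided_kernel k t *\<^sub>R cis (x * t) \<partial>lborel)"

lemma integrable_indicator_H_fun: "integrable lborel (\<lambda>t. indicator {0..} t * H_fun k t)"
  using set_integrable_H_fun by (simp add: set_integrable_def)

lemma integrable_two_sided_kernel: "integrable lborel (two_sided_kernel k)"
  unfolding two_sided_kernel_def
  by (intro Bochner_Integration.integrable_add integrable_mult_right integrable_indicator_H_fun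
      lborel_reflect(1)[of "\<lambda>t. indicator {0..} t * H_fun k t"])

text \<open>The two halves contribute at most twice the half-line integral, and 2 = (pi/2)(4/pi),
  with 4/pi the factor in \<open>C_const\<close>.\<close>

lemma integral_abs_two_sided_kernel_le: "(\<integral>t. \<bar>two_sided_kernel k t\<bar> \<partial>lborel) \<le> pi / 2 * C_const k"
proof -
  let ?h = "\<lambda>t. \<bar>indicator {0..} t * H_fun k t\<bar>"
  have i: "integrable lborel ?h"
    by (intro integrable_abs integrable_indicator_H_fun)
  have "(\<integral>t. \<bar>two_sided_kernel k t\<bar> \<partial>lborel) \<le> (\<integral>t. ?h t + ?h (- t) \<partial>lborel)"
  proof (rule integral_mono)
    fix t
    show "\<bar>two_sided_kernel k t\<bar> \<le> ?h t + ?h (- t)"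
      unfolding two_sided_kernel_def by (rule order_trans[OF abs_triangle_ineq]) (simp add: abs_mult power_abs)
  qed (use i lborel_reflect(1)[OF i] integrable_two_sided_kernel in auto)
  also have "\<dots> = 2 * (\<integral>t. ?h t \<partial>lborel)"
    using i lborel_reflect[OF i] by (simp only: Bochner_Integration.integral_add)
  also have "(\<integral>t. ?h t \<partial>lborel) = (LBINT t:{0..}. \<bar>H_fun k t\<bar>)"
    unfolding set_lebesgue_integral_def by (intro Bochner_Integration.integral_cong) (auto simp: indicator_def)
  finally show ?thesis by (simp add: C_const_def)
qed

lemma kernel_transform_eq: "kernel_transform k x = half_transform k x + (-1) ^ k * half_transform k (- x)"
proof -
  let ?h = "\<lambda>x t. indicator {0..} t *\<^sub>R (H_fun k t *\<^sub>R cis (x * t))"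
  have i: "integrable lborel (?h y)" for y
    using set_integrable_H_fun_cis by (simp add: set_integrable_def)
  have "kernel_transform k x = (\<integral>t. ?h x t + (-1) ^ k * ?h (- x) (- t) \<partial>lborel)"
    unfolding kernel_transform_def two_sided_kernel_def
    by (intro Bochner_Integration.integral_cong) (auto simp: scaleR_conv_of_real algebra_simps)
  also have "\<dots> = (\<integral>t. ?h x t \<partial>lborel) + (-1) ^ k * (\<integral>t. ?h (- x) t \<partial>lborel)"
    using lborel_reflect[OF i[of "- x"]] i[of x]
    by (simp only: Bochner_Integration.integral_add integrable_mult_right integral_mult_right_zero)
  finally show ?thesis by (simp add: half_transform_def set_lebesgue_integral_def)
qed

text \<open>The boundary values of the two half-lines cancel for odd \<open>k\<close> and add up for
  even \<open>k\<close>.\<close>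

lemma kernel_transform_Suc:
  "\<i> * of_real x * kernel_transform (Suc k) x
    = kernel_transform k x - (1 + (-1) ^ k) * of_real (H_fun (Suc k) 0)"
proof -
  have "\<i> * of_real x * kernel_transform (Suc k) x
    = \<i> * of_real x * half_transform (Suc k) x + (-1) ^ k * (\<i> * of_real (- x) * half_transform (Suc k) (- x))"
    by (simp add: kernel_transform_eq algebra_simps)
  then show ?thesis
    unfolding half_transform_Suc by (simp add: kernel_transform_eq algebra_simps del: H_fun.simps)
qed

text \<open>The absolute values are the form in which the four integrals of one minus cosine arrive;
  for |x| between 1 and 2 the formula equals 2 - |x|.\<close>

definition vallee_poussin :: "real \<Rightarrow> real" where
  "vallee_poussin x = (\<bar>2 + x\<bar> + \<bar>2 - x\<bar> - \<bar>1 + x\<bar> - \<bar>1 - x\<bar>) / 2"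

lemma vallee_poussin_eq_0: "2 \<le> x \<Longrightarrow> vallee_poussin x = 0"
  and vallee_poussin_eq_1: "\<bar>x\<bar> \<le> 1 \<Longrightarrow> vallee_poussin x = 1"
  by (auto simp: vallee_poussin_def abs_if split: if_splits)

lemma kernel_transform_0: "kernel_transform 0 x = of_real (pi / 2 * vallee_poussin x)"
proof -
  have "kernel_transform 0 x = (LBINT t:{0..}. H_fun 0 t *\<^sub>R cis (x * t) + H_fun 0 t *\<^sub>R cis (- x * t))"
    using set_integrable_H_fun_cis[of 0 x] set_integrable_H_fun_cis[of 0 "- x"]
    by (simp add: kernel_transform_eq half_transform_def set_integral_add del: H_fun.simps)
  also have "\<dots> = (LBINT t:{0..}. complex_of_real (2 * (H_fun 0 t * cos (x * t))))"
    unfolding set_lebesgue_integral_def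
    by (intro Bochner_Integration.integral_cong)
       (auto simp: complex_eq_iff simp del: H_fun.simps of_real_mult of_real_divide)
  also have "\<dots> = complex_of_real (LBINT t:{0..}. 2 * (H_fun 0 t * cos (x * t)))"
    unfolding set_lebesgue_integral_def
    by (subst integral_complex_of_real[symmetric], intro Bochner_Integration.integral_cong)
       (auto simp: scaleR_conv_of_real simp del: H_fun.simps)
  also have "(LBINT t:{0..}. 2 * (H_fun 0 t * cos (x * t))) = pi / 2 * vallee_poussin x"
    by (simp only: set_integral_mult_right H_fun_0_cos_integral vallee_poussin_def)
  finally show ?thesis .
qed

text \<open>This boundary value supplies the 1 in 1 - v: the first recurrence subtracts twice pi/4
  from pi/2 times v.\<close>

lemma H_fun_1_at_0: "H_fun (Suc 0) 0 = pi / 4"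
  using H_fun_0_cos_integral[of 0] by simp

text \<open>The transform of an integrable function is continuous, by dominated convergence. The
  multiplier identity alone gives no value at 0, since there a power of x multiplies the
  transform.\<close>

lemma kernel_transform_at_0:
  assumes "\<And>x. 0 < x \<Longrightarrow> x < 1 \<Longrightarrow> kernel_transform k x = 0"
  shows "kernel_transform k 0 = 0"
proof -
  \<comment> \<open>A null sequence inside (0, 1); the shift by 2 keeps \<open>x 0\<close> below
    1.\<close>
  define x where "x m = 1 / (real m + 2)" for m
  have x: "0 < x m" "x m < 1" for m by (auto simp: x_def field_simps)
  have "x \<longlonglongrightarrow> 0" unfolding x_def by real_asymp
  have L: "two_sided_kernel k \<in> borel_measurable borel"
    using integrable_two_sided_kernel[of k] by auto
  have c: "(\<lambda>t. cis (y * t)) \<in> borel_measurable borel" for y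
    by (intro borel_measurable_continuous_onI continuous_intros)
  have "(\<lambda>m. kernel_transform k (x m)) \<longlonglongrightarrow> kernel_transform k 0"
    unfolding kernel_transform_def
  proof (rule integral_dominated_convergence)
    show "integrable lborel (\<lambda>t. \<bar>two_sided_kernel k t\<bar>)"
      by (intro integrable_abs integrable_two_sided_kernel)
    have "continuous_on UNIV (\<lambda>y. cis (y * t))" for t by (intro continuous_intros)
    then have "isCont (\<lambda>y. cis (y * t)) 0" for t by (simp add: continuous_on_eq_continuous_at)
    then show "AE t in lborel. (\<lambda>m. two_sided_kernel k t *\<^sub>R cis (x m * t)) \<longlonglongrightarrow> two_sided_kernel k t *\<^sub>R cis (0 * t)"
      using isCont_tendsto_compose[OF _ \<open>x \<longlonglongrightarrow> 0\<close>] by (intro AE_I2 tendsto_scaleR tendsto_const) blast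
  qed (use L c in \<open>auto intro!: borel_measurable_scaleR\<close>)
  then have "(\<lambda>m. 0) \<longlonglongrightarrow> kernel_transform k 0"
    using assms x by simp
  then show ?thesis by (simp add: LIMSEQ_const_iff)
qed

text \<open>The boundary terms \<open>H\<^sub>k(0)\<close> for odd \<open>k \<ge> 3\<close> vanish because \<open>1 - v\<close> is zero near the
  origin.\<close>

lemma kernel_transform_multiplier:
  "(\<i> * of_real x) ^ Suc k * kernel_transform (Suc k) x = - of_real (pi / 2 * (1 - vallee_poussin x))"
proof (induction k arbitrary: x)
  case 0
  show ?case
  proof -
    have "\<i> * of_real x * kernel_transform (Suc 0) x = of_real (pi / 2 * vallee_poussin x) - (1 + 1) * of_real (pi / 4)"
      by (simp only: kernel_transform_Suc kernel_transform_0 H_fun_1_at_0 power_0)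
    also have "\<dots> = - of_real (pi / 2 * (1 - vallee_poussin x))"
      by (simp add: field_simps)
    finally show ?thesis by simp
  qed
next
  case (Suc k)
  have "(1 + (-1) ^ Suc k) * of_real (H_fun (Suc (Suc k)) 0) = (0 :: complex)"
  proof (cases "even (Suc k)")
    case True
    have "kernel_transform (Suc k) 0 = 0"
    proof (rule kernel_transform_at_0)
      fix x :: real assume x: "0 < x" "x < 1"
      then show "kernel_transform (Suc k) x = 0"
        using Suc[of x] vallee_poussin_eq_1[of x] by simp
    qed
    \<comment> \<open>At x = 0 the left side of the recurrence is zero, so twice the boundary value
      equals the transform at 0, which has just been shown to vanish.\<close>
    then show ?thesis
      using kernel_transform_Suc[of 0 "Suc k"] True by (simp del: H_fun.simps)
  qed simp
  then have "\<i> * of_real x * kernel_transform (Suc (Suc k)) x = kernel_transform (Suc k) x"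
    by (simp only: kernel_transform_Suc diff_0_right)
  then have "(\<i> * of_real x) ^ Suc (Suc k) * kernel_transform (Suc (Suc k)) x
      = (\<i> * of_real x) ^ Suc k * kernel_transform (Suc k) x"
    by (simp only: power_Suc2[of _ "Suc k"] mult.assoc)
  then show ?case using Suc[of x] by (simp only:)
qed

lemma C_const_nonneg: "0 \<le> C_const k"
  by (simp add: C_const_def set_lebesgue_integral_def)

text \<open>The integral of \<open>H_fun 0\<close> without absolute value is pi/4, which the factor
  4/pi turns into exactly 1.\<close>

lemma C_const_0_ge_1: "1 \<le> C_const 0"
proof -
  have "(LBINT t:{0..}. H_fun 0 t) \<le> (LBINT t:{0..}. \<bar>H_fun 0 t\<bar>)"
    by (intro set_integral_mono set_integrable_abs set_integrable_H_fun abs_ge_self)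
  moreover have "(LBINT t:{0..}. H_fun 0 t) = pi / 4"
    using H_fun_1_at_0 by simp
  ultimately show ?thesis by (simp add: C_const_def field_simps del: H_fun.simps)
qed

section \<open>Angular derivatives and power series\<close>

text \<open>The angular derivative in complex form, by the chain rule along r e^(i theta). As an
  operator on functions of z it can be iterated without choosing an argument.\<close>

definition angular :: "(complex \<Rightarrow> complex) \<Rightarrow> complex \<Rightarrow> complex" where
  "angular f z = \<i> * z * deriv f z"

lemma angular_holomorphic:
  "f holomorphic_on ball 0 1 \<Longrightarrow> (angular ^^ K) f holomorphic_on ball 0 1"
  by (induction K) (auto simp: angular_def[abs_def] intro!: holomorphic_intros)

text \<open>An equality of functions of the angle, not of values, since the next derivative needs
  all nearby angles.\<close>

lemma iterated_vector_derivative_circle: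
  assumes f: "f holomorphic_on ball 0 1" and r: "\<bar>r\<bar> < 1"
  shows "((\<lambda>g \<theta>. vector_derivative g (at \<theta>)) ^^ K) (\<lambda>\<theta>. f (rcis r \<theta>)) = (\<lambda>\<theta>. (angular ^^ K) f (rcis r \<theta>))"
proof (induction K)
  case (Suc K)
  have "((\<lambda>\<theta>. (angular ^^ K) f (rcis r \<theta>)) has_vector_derivative (angular ^^ Suc K) f (rcis r \<theta>)) (at \<theta>)" for \<theta>
  proof -
    have "((\<lambda>z. of_real r * exp (\<i> * z)) has_field_derivative \<i> * (of_real r * exp (\<i> * of_real \<theta>))) (at (of_real \<theta>))"
      by (auto intro!: derivative_eq_intros)
    from has_vector_derivative_real_field[OF this]
    have *: "(rcis r has_vector_derivative \<i> * rcis r \<theta>) (at \<theta>)"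
      by (simp add: rcis_def[abs_def] cis_conv_exp)
    have "rcis r \<theta> \<in> ball 0 1" using r by simp
    then have "((angular ^^ K) f has_field_derivative deriv ((angular ^^ K) f) (rcis r \<theta>)) (at (rcis r \<theta>))"
      using holomorphic_derivI[OF angular_holomorphic[OF f]] by blast
    from field_vector_diff_chain_at[OF * this] show ?thesis
      by (simp add: o_def angular_def)
  qed
  then have "vector_derivative (\<lambda>\<theta>. (angular ^^ K) f (rcis r \<theta>)) (at \<theta>) = (angular ^^ Suc K) f (rcis r \<theta>)" for \<theta>
    by (rule vector_derivative_at)
  then show ?case
    using Suc by simp
qed simp

lemma angular_deriv_eq:
  assumes "f holomorphic_on ball 0 1" "z \<in> ball 0 1"
  shows "angular_deriv K f z = (angular ^^ K) f z"
  using assms iterated_vector_derivative_circle[of f "cmod z" K]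
  by (simp add: angular_deriv_def rcis_cmod_Arg)

text \<open>Monomials are eigenfunctions of \<open>angular\<close> with eigenvalue ij, and a power
  series may be differentiated term by term inside its disc of convergence.\<close>

lemma angular_power_series:
  assumes "\<And>z. z \<in> ball 0 1 \<Longrightarrow> (\<lambda>j. a j * z ^ j) sums f z" and "z \<in> ball 0 1"
  shows "(\<lambda>j. (\<i> * of_nat j) ^ K * a j * z ^ j) sums (angular ^^ K) f z"
  using assms(2)
proof (induction K arbitrary: z)
  case 0
  then show ?case using assms(1) by simp
next
  case (Suc K)
  let ?b = "\<lambda>j. (\<i> * of_nat j) ^ K * a j" and ?g = "(angular ^^ K) f"
  \<comment> \<open>A real point halfway between the modulus of z and 1: convergence there leaves
    room for differentiating at z.\<close>
  define x where "x = complex_of_real ((1 + cmod z) / 2)"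
  have x: "cmod z < cmod x" "x \<in> ball 0 1"
    using Suc.prems by (auto simp: x_def norm_divide field_simps simp del: of_real_add of_real_divide)
  have sx: "summable (\<lambda>j. ?b j * x ^ j)"
    using Suc.IH[OF x(2)] by (rule sums_summable)
  have "((\<lambda>w. \<Sum>j. ?b j * w ^ j) has_field_derivative (\<Sum>j. diffs ?b j * z ^ j)) (at z)"
    by (rule termdiffs_strong[OF sx x(1)])
  then have "(?g has_field_derivative (\<Sum>j. diffs ?b j * z ^ j)) (at z)"
    by (rule has_field_derivative_transform_within_open[where S = "ball 0 1"])
       (use Suc.prems Suc.IH in \<open>auto simp: sums_iff\<close>)
  then have d: "deriv ?g z = (\<Sum>j. diffs ?b j * z ^ j)"
    by (rule DERIV_imp_deriv)
  have "summable (\<lambda>j. diffs ?b j * z ^ j)"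
    using x(1) by (intro termdiff_converges[where K = "cmod x"])
      (auto intro!: powser_inside[OF sx] sums_summable[OF Suc.IH] order.strict_trans[OF _ x(2)[simplified]])
  then have "(\<lambda>j. of_nat j * ?b j * z ^ (j - Suc 0)) sums deriv ?g z"
    unfolding d by (rule diffs_equiv)
  then have "(\<lambda>j. \<i> * z * (of_nat j * ?b j * z ^ (j - Suc 0))) sums (\<i> * z * deriv ?g z)"
    by (rule sums_mult)
  also have "(\<lambda>j. \<i> * z * (of_nat j * ?b j * z ^ (j - Suc 0))) = (\<lambda>j. (\<i> * of_nat j) ^ Suc K * a j * z ^ j)"
  proof
    fix j
    show "\<i> * z * (of_nat j * ?b j * z ^ (j - Suc 0)) = (\<i> * of_nat j) ^ Suc K * a j * z ^ j"
      by (cases j) (auto simp: algebra_simps)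
  qed
  finally show ?case by (simp add: angular_def)
qed

text \<open>Rotation by ct multiplies z^j by cis(cjt), so averaging over rotations acts on the
  coefficients through the Fourier transform of \<open>L\<close> at cj. Absolute convergence at z
  and integrability of \<open>L\<close> allow the exchange of sum and integral.\<close>

lemma convolution_power_series:
  fixes L :: "real \<Rightarrow> real" and b :: "nat \<Rightarrow> complex"
  assumes L: "integrable lborel L"
    and g: "\<And>z. z \<in> ball 0 1 \<Longrightarrow> (\<lambda>j. b j * z ^ j) sums g z" and z: "z \<in> ball 0 1"
  shows "(\<lambda>j. b j * z ^ j * (\<integral>t. L t *\<^sub>R cis (c * real j * t) \<partial>lborel)) sums
    (\<integral>t. L t *\<^sub>R g (z * cis (c * t)) \<partial>lborel)"
proof -
  define x where "x = complex_of_real ((1 + cmod z) / 2)"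
  have x: "cmod z < cmod x" "x \<in> ball 0 1"
    using z by (auto simp: x_def norm_divide field_simps simp del: of_real_add of_real_divide)
  have abs: "summable (\<lambda>j. norm (b j * z ^ j))"
    using sums_summable[OF g[OF x(2)]] x(1) by (rule powser_insidea)
  let ?f = "\<lambda>j t. L t *\<^sub>R (b j * (z * cis (c * t)) ^ j)"
  have f_eq: "?f j t = b j * z ^ j * (L t *\<^sub>R cis (c * real j * t))" for j t
    by (simp add: power_mult_distrib Complex.DeMoivre scaleR_conv_of_real mult_ac)
  have int: "integrable lborel (\<lambda>t. L t *\<^sub>R cis (y * t))" for y
  proof (rule Bochner_Integration.integrable_bound[OF L])
    have "(\<lambda>t. cis (y * t)) \<in> borel_measurable borel"
      by (intro borel_measurable_continuous_onI continuous_intros)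
    then show "(\<lambda>t. L t *\<^sub>R cis (y * t)) \<in> borel_measurable lborel"
      using L by (intro borel_measurable_scaleR) auto
  qed auto
  have norm_f: "norm (?f j t) = \<bar>L t\<bar> * norm (b j * z ^ j)" for j t
    by (simp add: norm_mult norm_power)
  have "(\<lambda>j. integral\<^sup>L lborel (?f j)) sums (\<integral>t. (\<Sum>j. ?f j t) \<partial>lborel)"
  proof (rule sums_integral)
    show "integrable lborel (?f j)" for j
      unfolding f_eq by (intro integrable_mult_right int)
    show "AE t in lborel. summable (\<lambda>j. norm (?f j t))"
      unfolding norm_f by (intro AE_I2 summable_mult abs)
    show "summable (\<lambda>j. \<integral>t. norm (?f j t) \<partial>lborel)"
      unfolding norm_f integral_mult_left_zero by (intro summable_mult abs)
  qed
  also have "(\<lambda>j. integral\<^sup>L lborel (?f j)) = (\<lambda>j. b j * z ^ j * (\<integral>t. L t *\<^sub>R cis (c * real j * t) \<partial>lborel))"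
    unfolding f_eq integral_mult_right_zero ..
  also have "(\<integral>t. (\<Sum>j. ?f j t) \<partial>lborel) = (\<integral>t. L t *\<^sub>R g (z * cis (c * t)) \<partial>lborel)"
  proof (intro Bochner_Integration.integral_cong refl)
    fix t
    have "z * cis (c * t) \<in> ball 0 1" using z by (simp add: norm_mult)
    then show "(\<Sum>j. ?f j t) = L t *\<^sub>R g (z * cis (c * t))"
      using sums_scaleR_right[OF g] by (simp add: sums_iff)
  qed
  finally show ?thesis .
qed

section \<open>The estimate for best approximation\<close>

lemma bergman_norm_cong:
  assumes "\<And>z. z \<in> ball 0 1 \<Longrightarrow> f z = g z"
  shows "bergman_norm p \<alpha> f = bergman_norm p \<alpha> g"
proof -
  have "(\<integral>\<^sup>+z. ennreal (cmod (f z) powr p) \<partial>disc_measure \<alpha>) = (\<integral>\<^sup>+z. ennreal (cmod (g z) powr p) \<partial>disc_measure \<alpha>)"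
    using assms by (intro nn_integral_cong) simp
  then show ?thesis by (simp only: bergman_norm_def)
qed

text \<open>The existence of a minimiser identifies the \<open>LEAST\<close> value with an actual
  norm, which then lies below that of every competitor.\<close>

lemma best_approx_le:
  assumes p: "1 < p" and \<alpha>: "-1 < \<alpha>" and f: "f \<in> bergman_space p \<alpha>" and P: "degree P \<le> n"
  shows "best_approx p \<alpha> n f \<le> bergman_norm p \<alpha> (\<lambda>z. f z - poly P z)"
proof -
  have "f \<in> borel_measurable (disc_measure \<alpha>)"
    using f by (intro continuous_imp_measurable_disc holomorphic_on_imp_continuous_on) (simp add: bergman_space_def)
  moreover have "(\<integral>\<^sup>+z. ennreal (cmod (f z) powr p) \<partial>disc_measure \<alpha>) < \<infinity>"
    using f by (auto simp: bergman_space_def bergman_norm_def Let_def less_top split: if_splits)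
  ultimately obtain Q where Q: "degree Q \<le> n"
    and min: "\<And>R. degree R \<le> n \<Longrightarrow>
      (\<integral>\<^sup>+z. ennreal (cmod (f z - poly Q z) powr p) \<partial>disc_measure \<alpha>) \<le> (\<integral>\<^sup>+z. ennreal (cmod (f z - poly R z) powr p) \<partial>disc_measure \<alpha>)"
    using best_poly_exists[OF p \<alpha>, of f n] by blast
  have "best_approx p \<alpha> n f = bergman_norm p \<alpha> (\<lambda>z. f z - poly Q z)"
    unfolding best_approx_def
  proof (rule Least_equality)
    show "\<exists>P. degree P \<le> n \<and> bergman_norm p \<alpha> (\<lambda>z. f z - poly Q z) = bergman_norm p \<alpha> (\<lambda>z. f z - poly P z)"
      using Q by blast
  next
    fix y assume "\<exists>P. degree P \<le> n \<and> y = bergman_norm p \<alpha> (\<lambda>z. f z - poly P z)"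
    then obtain R where "degree R \<le> n" "y = bergman_norm p \<alpha> (\<lambda>z. f z - poly R z)" by blast
    then show "bergman_norm p \<alpha> (\<lambda>z. f z - poly Q z) \<le> y"
      using bergman_norm_mono_integral[OF p min] by simp
  qed
  then show ?thesis
    using bergman_norm_mono_integral[OF p min[OF P]] by simp
qed

lemma best_approx_le_Suc:
  assumes p: "1 < p" and \<alpha>: "-1 < \<alpha>" and f: "f \<in> bergman_space p \<alpha>" and M: "0 \<le> M"
    and dM: "bergman_norm p \<alpha> (angular_deriv (Suc k) f) \<le> ennreal M" and n: "1 \<le> n"
  shows "best_approx p \<alpha> n f \<le> ennreal (2 ^ Suc k * C_const (Suc k) * M / real n ^ Suc k)"
proof -
  let ?K = "Suc k"
  define a where "a j = (deriv ^^ j) f 0 / fact j" for j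
  \<comment> \<open>The minus sign and 2/pi cancel the factor -pi/2 of
    \<open>kernel_transform_multiplier\<close>; the power of 2/n makes up for its argument 2j/n
    against the bare j of the angular derivative.\<close>
  define s where "s = - (2 / pi) * (2 / real n) ^ ?K"
  define L where "L t = s * two_sided_kernel ?K t" for t
  \<comment> \<open>Cutting the sum at n loses nothing: from j = n on the factor is already
    zero.\<close>
  define P where "P = (\<Sum>j\<le>n. monom (of_real (vallee_poussin (2 / real n * real j)) * a j) j)"
  have hol: "f holomorphic_on ball 0 1" using f by (simp add: bergman_space_def)
  have ser: "(\<lambda>j. a j * z ^ j) sums f z" if "z \<in> ball 0 1" for z
    using holomorphic_power_series[OF hol that] by (simp add: a_def)
  have L: "integrable lborel L"
    unfolding L_def by (intro integrable_mult_right integrable_two_sided_kernel)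
  have eq: "f z - poly P z = (\<integral>t. L t *\<^sub>R (angular ^^ ?K) f (z * cis (2 / real n * t)) \<partial>lborel)"
    if z: "z \<in> ball 0 1" for z
  proof -
    have "(\<lambda>j. (\<i> * of_nat j) ^ ?K * a j * z ^ j * (\<integral>t. L t *\<^sub>R cis (2 / real n * real j * t) \<partial>lborel)) sums
        (\<integral>t. L t *\<^sub>R (angular ^^ ?K) f (z * cis (2 / real n * t)) \<partial>lborel)"
      by (rule convolution_power_series[OF L angular_power_series[OF ser] z])
    \<comment> \<open>Coefficientwise form of the claim. For j = 0 both sides vanish, because
      \<open>?K\<close> is positive and v(0) = 1.\<close>
    moreover have "(\<i> * of_nat j) ^ ?K * a j * z ^ j * (\<integral>t. L t *\<^sub>R cis (2 / real n * real j * t) \<partial>lborel)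
        = a j * z ^ j - (if j \<le> n then of_real (vallee_poussin (2 / real n * real j)) * a j * z ^ j else 0)" for j
    proof -
      let ?x = "2 / real n * real j"
      have "(\<integral>t. L t *\<^sub>R cis (?x * t) \<partial>lborel) = of_real s * kernel_transform ?K ?x"
        unfolding L_def kernel_transform_def scaleR_scaleR[symmetric] integral_scaleR_right
        by (simp add: scaleR_conv_of_real)
      moreover have "(\<i> * of_nat j) ^ ?K * of_real s = - (2 / of_real pi) * (\<i> * of_real ?x) ^ ?K"
      proof -
        have "\<i> * of_real ?x = (\<i> * of_nat j) * of_real (2 / real n)" by simp
        then have "(\<i> * of_real ?x) ^ ?K = (\<i> * of_nat j) ^ ?K * of_real ((2 / real n) ^ ?K)"
          by (simp only: power_mult_distrib of_real_power)
        then have "(\<i> * of_nat j) ^ ?K * of_real s = of_real (- (2 / pi)) * (\<i> * of_real ?x) ^ ?K"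
          by (simp only: s_def of_real_mult mult_ac)
        then show ?thesis by (simp only: of_real_minus of_real_divide of_real_numeral)
      qed
      ultimately have "(\<i> * of_nat j) ^ ?K * (\<integral>t. L t *\<^sub>R cis (?x * t) \<partial>lborel)
          = - (2 / of_real pi) * ((\<i> * of_real ?x) ^ ?K * kernel_transform ?K ?x)"
        by (metis mult.assoc)
      also have "\<dots> = 1 - of_real (vallee_poussin ?x)"
        unfolding kernel_transform_multiplier by (simp add: field_simps)
      finally have *: "(\<i> * of_nat j) ^ ?K * (\<integral>t. L t *\<^sub>R cis (?x * t) \<partial>lborel) = 1 - of_real (vallee_poussin ?x)" .
      have "(\<i> * of_nat j) ^ ?K * a j * z ^ j * (\<integral>t. L t *\<^sub>R cis (?x * t) \<partial>lborel)
          = a j * z ^ j * ((\<i> * of_nat j) ^ ?K * (\<integral>t. L t *\<^sub>R cis (?x * t) \<partial>lborel))"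
        by (simp only: mult_ac)
      also have "\<dots> = a j * z ^ j * (1 - of_real (vallee_poussin ?x))"
        by (simp only: *)
      finally have "(\<i> * of_nat j) ^ ?K * a j * z ^ j * (\<integral>t. L t *\<^sub>R cis (?x * t) \<partial>lborel)
          = a j * z ^ j * (1 - of_real (vallee_poussin ?x))" .
      also have "\<dots> = a j * z ^ j - (if j \<le> n then of_real (vallee_poussin ?x) * a j * z ^ j else 0)"
      proof (cases "j \<le> n")
        case False
        then have "vallee_poussin ?x = 0"
          using n by (intro vallee_poussin_eq_0) (simp add: field_simps)
        then show ?thesis using False by simp
      qed (simp add: algebra_simps)
      finally show ?thesis .
    qed
    moreover have "(\<lambda>j. a j * z ^ j - (if j \<le> n then of_real (vallee_poussin (2 / real n * real j)) * a j * z ^ j else 0))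
        sums (f z - poly P z)"
    proof (rule sums_diff[OF ser[OF z]])
      have "poly P z = (\<Sum>j\<le>n. of_real (vallee_poussin (2 / real n * real j)) * a j * z ^ j)"
        by (simp add: P_def poly_sum poly_monom)
      then show "(\<lambda>j. if j \<le> n then of_real (vallee_poussin (2 / real n * real j)) * a j * z ^ j else 0) sums poly P z"
        using sums_If_finite_set[of "{..n}" "\<lambda>j. of_real (vallee_poussin (2 / real n * real j)) * a j * z ^ j"] by simp
    qed
    ultimately show ?thesis by (metis (no_types, lifting) sums_cong sums_unique2)
  qed
  have "degree P \<le> n"
    unfolding P_def by (intro degree_sum_le) (auto intro: order_trans[OF degree_monom_le])
  then have "best_approx p \<alpha> n f \<le> bergman_norm p \<alpha> (\<lambda>z. f z - poly P z)"
    by (rule best_approx_le[OF p \<alpha> f])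
  also have "\<dots> = bergman_norm p \<alpha> (\<lambda>z. \<integral>t. L t *\<^sub>R (angular ^^ ?K) f (z * cis (2 / real n * t)) \<partial>lborel)"
    by (rule bergman_norm_cong[OF eq])
  also have "\<dots> \<le> ennreal ((\<integral>t. \<bar>L t\<bar> \<partial>lborel) * M)"
  proof (rule bergman_norm_convolution_le[OF p M L])
    show "continuous_on (ball 0 1) ((angular ^^ ?K) f)"
      by (intro holomorphic_on_imp_continuous_on angular_holomorphic hol)
    show "bergman_norm p \<alpha> ((angular ^^ ?K) f) \<le> ennreal M"
      using dM bergman_norm_cong[of "angular_deriv ?K f" "(angular ^^ ?K) f"] angular_deriv_eq[OF hol]
      by metis
  qed
  also have "\<dots> \<le> ennreal (2 ^ ?K * C_const ?K * M / real n ^ ?K)"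
  proof (rule ennreal_leI)
    have "(\<integral>t. \<bar>L t\<bar> \<partial>lborel) = \<bar>s\<bar> * (\<integral>t. \<bar>two_sided_kernel ?K t\<bar> \<partial>lborel)"
      by (simp add: L_def abs_mult)
    also have "\<dots> \<le> \<bar>s\<bar> * (pi / 2 * C_const ?K)"
      by (intro mult_left_mono integral_abs_two_sided_kernel_le) auto
    also have "\<bar>s\<bar> = 2 / pi * (2 / real n) ^ ?K"
      by (simp add: s_def abs_mult)
    finally have "(\<integral>t. \<bar>L t\<bar> \<partial>lborel) \<le> 2 ^ ?K * C_const ?K / real n ^ ?K"
      by (simp add: power_divide mult_ac)
    then show "(\<integral>t. \<bar>L t\<bar> \<partial>lborel) * M \<le> 2 ^ ?K * C_const ?K * M / real n ^ ?K"
      using mult_right_mono[OF _ M] by fastforce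
  qed
  finally show ?thesis .
qed

theorem theorem2p2:
  fixes p \<alpha> M :: real and K :: nat and f :: "complex \<Rightarrow> complex"
  assumes "1 < p" and "-1 < \<alpha>"
    and "f \<in> bergman_space p \<alpha>"
    and "bergman_norm p \<alpha> (angular_deriv K f) \<le> ennreal M"
  shows "\<forall>n::nat. n \<ge> 1 \<longrightarrow>
           best_approx p \<alpha> n f \<le> ennreal (2 ^ K * C_const K * M * real n powi (- int K))"
proof (intro allI impI)
  fix n :: nat assume n: "1 \<le> n"
  \<comment> \<open>A negative \<open>M\<close> becomes 0 as an extended real, whereas the estimate
    for averages takes a nonnegative real.\<close>
  define m where "m = max M 0"
  have m: "0 \<le> m" and Mm: "ennreal M = ennreal m"
    by (auto simp: m_def max_def ennreal_neg)
  have "best_approx p \<alpha> n f \<le> ennreal (2 ^ K * C_const K * m / real n ^ K)"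
  proof (cases K)
    case 0
    have "best_approx p \<alpha> n f \<le> bergman_norm p \<alpha> (\<lambda>z. f z - poly 0 z)"
      by (rule best_approx_le[OF assms(1-3)]) simp
    also have "\<dots> = bergman_norm p \<alpha> (angular_deriv 0 f)"
      by (rule bergman_norm_cong) (simp add: angular_deriv_def rcis_cmod_Arg)
    also have "\<dots> \<le> ennreal m" using assms(4) by (simp add: 0 Mm)
    also have "\<dots> \<le> ennreal (C_const 0 * m)"
      using mult_right_mono[OF C_const_0_ge_1 m] by (intro ennreal_leI) simp
    finally show ?thesis by (simp add: 0)
  next
    case (Suc k)
    show ?thesis
      using best_approx_le_Suc[OF assms(1-3) m _ n, of k] assms(4) unfolding Suc Mm by blast
  qed
  also have "\<dots> = ennreal (2 ^ K * C_const K * M * real n powi (- int K))"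
  proof (cases "0 \<le> M")
    case True
    then show ?thesis by (simp add: m_def power_int_minus divide_inverse)
  next
    case False
    \<comment> \<open>\<open>ennreal\<close> truncates this nonpositive bound to 0, in agreement
      with \<open>m\<close> being 0.\<close>
    then have "2 ^ K * C_const K * M * real n powi (- int K) \<le> 0"
      by (intro mult_nonpos_nonneg mult_nonneg_nonpos) (auto simp: C_const_nonneg)
    then show ?thesis using False by (simp add: m_def ennreal_neg max_def)
  qed
  finally show "best_approx p \<alpha> n f \<le> ennreal (2 ^ K * C_const K * M * real n powi (- int K))" .
qed

end
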